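(* Let $-A$ be the generator of an asymptotically analytic $C_0$-semigroup $(T(t))_{t\ge0}$ on a Banach space $X$ such that $\mathbb{C}_-\subseteq\rho(A)$. Suppose that there exists a nondecreasing $g:(0,\infty)\to(0,\infty)$ such that $$\|(\lambda+A)^{-1}\|_{\mathcal{L}(X)}\le g(\mathrm{Re}(\lambda)^{-1})\qquad(\lambda\in\mathbb{C}_+).$$ Then there exists a $C\ge0$ such that $\|T(t)\|_{\mathcal{L}(X)}\le C(g(t)+1)$ for all $t>0$.
   Context: Banach spaces are nonzero and over $\mathbb{C}$; $\mathcal{L}(X)$ is the space of bounded operators on $X$. $\mathbb{C}_+=\{\mathrm{Re}(\lambda)>0\}$, $\mathbb{C}_-=-\mathbb{C}_+$; $\rho(A)$ is the resolvent set of $A$. The non-analytic growth bound of a $C_0$-semigroup $T$ on $X$ is $$\zeta(T)=\inf\Big\{\omega\in\mathbb{R}:\ \sup_{t>0}e^{-\omega t}\|T(t)-S(t)\|_{\mathcal L(X)}<\infty\ \text{for some } S\in\mathcal{H}(\mathcal{L}(X))\Big\},$$ where $\mathcal{H}(\mathcal{L}(X))$ is the set of all $S:(0,\infty)\to\mathcal{L}(X)$ having an exponentially bounded analytic extension to some sector containing $(0,\infty)$. The semigroup is asymptotically analytic if $\zeta(T)<0$. *)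

theory Defs
  imports "HOL-Complex_Analysis.Complex_Analysis"
begin

section \<open>Complex normed and Banach spaces\<close>

class complex_normed_vector = real_normed_vector +
  fixes scaleC :: "complex \<Rightarrow> 'a \<Rightarrow> 'a" (infixr "*\<^sub>C" 75)
  assumes scaleC_add_right: "a *\<^sub>C (x + y) = a *\<^sub>C x + a *\<^sub>C y"
    and scaleC_add_left: "(a + b) *\<^sub>C x = a *\<^sub>C x + b *\<^sub>C x"
    and scaleC_scaleC: "a *\<^sub>C (b *\<^sub>C x) = (a * b) *\<^sub>C x"
    and scaleC_of_real: "complex_of_real r *\<^sub>C x = r *\<^sub>R x"
    and norm_scaleC: "norm (a *\<^sub>C x) = cmod a * norm x"

class complex_banach = complex_normed_vector + complete_space

subclass (in complex_banach) banach ..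

instantiation complex :: complex_banach
begin

definition scaleC_complex :: "complex \<Rightarrow> complex \<Rightarrow> complex"
  where "scaleC_complex a x = a * x"

instance
  by standard (auto simp: scaleC_complex_def algebra_simps norm_mult scaleR_conv_of_real)

end

lemma bounded_linear_scaleC_right:
  "bounded_linear (\<lambda>x::'a::complex_normed_vector. a *\<^sub>C x)"
proof (rule bounded_linear_intro[where K = "cmod a"])
  fix r :: real and x :: 'a
  show "a *\<^sub>C (r *\<^sub>R x) = r *\<^sub>R (a *\<^sub>C x)"
    by (metis scaleC_of_real scaleC_scaleC mult.commute)
qed (auto simp: scaleC_add_right norm_scaleC mult.commute)

text \<open>The library type of bounded \<^emph>\<open>real\<close>-linear maps becomes a complex normed space through
  the scalar multiplication of the codomain.\<close>

instantiation blinfun :: (real_normed_vector, complex_normed_vector) complex_normed_vector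
begin

definition scaleC_blinfun :: "complex \<Rightarrow> ('a \<Rightarrow>\<^sub>L 'b) \<Rightarrow> 'a \<Rightarrow>\<^sub>L 'b"
  where "scaleC_blinfun a B = Blinfun (\<lambda>x. a *\<^sub>C blinfun_apply B x)"

lemma scaleC_blinfun_apply [simp]:
  "blinfun_apply (a *\<^sub>C B) x = a *\<^sub>C blinfun_apply (B :: 'a \<Rightarrow>\<^sub>L 'b) x"
  unfolding scaleC_blinfun_def
  by (rule bounded_linear_Blinfun_apply[THEN fun_cong])
     (rule bounded_linear_compose[OF bounded_linear_scaleC_right blinfun.bounded_linear_right])

instance
proof
  fix a b :: complex and r :: real and A B :: "'a \<Rightarrow>\<^sub>L 'b"
  show "a *\<^sub>C (A + B) = a *\<^sub>C A + a *\<^sub>C B"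
    by (rule blinfun_eqI) (simp add: blinfun.add_left scaleC_add_right)
  show "(a + b) *\<^sub>C A = a *\<^sub>C A + b *\<^sub>C A"
    by (rule blinfun_eqI) (simp add: blinfun.add_left scaleC_add_left)
  show "a *\<^sub>C (b *\<^sub>C A) = (a * b) *\<^sub>C A"
    by (rule blinfun_eqI) (simp add: scaleC_scaleC)
  show "complex_of_real r *\<^sub>C A = r *\<^sub>R A"
    by (rule blinfun_eqI) (simp add: blinfun.scaleR_left scaleC_of_real)
  have le: "norm (c *\<^sub>C D) \<le> cmod c * norm D" for c and D :: "'a \<Rightarrow>\<^sub>L 'b"
    by (rule norm_blinfun_bound)
       (auto simp: norm_scaleC mult.assoc intro: mult_left_mono norm_blinfun)
  show "norm (a *\<^sub>C A) = cmod a * norm A"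
  proof (cases "a = 0")
    case True
    then show ?thesis using le[of a A] by simp
  next
    case False
    have "inverse a *\<^sub>C (a *\<^sub>C A) = A"
      using False scaleC_of_real[of 1] by (intro blinfun_eqI) (simp add: scaleC_scaleC)
    then have "norm A \<le> inverse (cmod a) * norm (a *\<^sub>C A)"
      using le[of "inverse a" "a *\<^sub>C A"] by (simp add: norm_inverse)
    then have "cmod a * norm A \<le> norm (a *\<^sub>C A)"
      using False by (simp add: field_simps)
    then show ?thesis using le[of a A] by linarith
  qed
qed

end

text \<open>The space $\mathcal{L}(X)$: the complex-linear elements of the library type of bounded
  real-linear maps, with the operator norm of that type.\<close>

definition bounded_operators :: "('a::complex_normed_vector \<Rightarrow>\<^sub>L 'a) set"
  where "bounded_operators = {B. \<forall>c x. blinfun_apply B (c *\<^sub>C x) = c *\<^sub>C blinfun_apply B x}"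


section \<open>Semigroups, generators and resolvents\<close>

text \<open>A semigroup is a family indexed by \<^typ>\<open>real\<close> of which only the values at
  $t \ge 0$ are relevant.\<close>

definition C0_semigroup :: "(real \<Rightarrow> 'a::complex_banach \<Rightarrow>\<^sub>L 'a) \<Rightarrow> bool"
  where "C0_semigroup T \<longleftrightarrow>
    (\<forall>t\<ge>0. T t \<in> bounded_operators) \<and>
    T 0 = id_blinfun \<and>
    (\<forall>s\<ge>0. \<forall>t\<ge>0. T (s + t) = T s o\<^sub>L T t) \<and>
    (\<forall>x. continuous_on {0..} (\<lambda>t. blinfun_apply (T t) x))"

text \<open>An unbounded operator is given by its domain \<open>D\<close> and a function of which only the values
  on \<open>D\<close> are relevant.\<close>

definition is_generator ::
    "(real \<Rightarrow> 'a::complex_banach \<Rightarrow>\<^sub>L 'a) \<Rightarrow> 'a set \<Rightarrow> ('a \<Rightarrow> 'a) \<Rightarrow> bool"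
  where "is_generator T D G \<longleftrightarrow>
    D = {x. \<exists>y. ((\<lambda>t. (1 / t) *\<^sub>R (blinfun_apply (T t) x - x)) \<longlongrightarrow> y) (at_right 0)} \<and>
    (\<forall>x\<in>D. ((\<lambda>t. (1 / t) *\<^sub>R (blinfun_apply (T t) x - x)) \<longlongrightarrow> G x) (at_right 0))"

definition resolvent_set :: "'a::complex_banach set \<Rightarrow> ('a \<Rightarrow> 'a) \<Rightarrow> complex set"
  where "resolvent_set D A =
    {z. bij_betw (\<lambda>x. z *\<^sub>C x - A x) D UNIV \<and>
        (\<exists>R\<in>bounded_operators. blinfun_apply R = the_inv_into D (\<lambda>x. z *\<^sub>C x - A x))}"


section \<open>The non-analytic growth bound\<close>

definition sector :: "real \<Rightarrow> complex set"
  where "sector \<phi> = {z. z \<noteq> 0 \<and> \<bar>Arg z\<bar> < \<phi>}"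

text \<open>\<^const>\<open>holomorphic_on\<close> is restricted to complex-valued functions; this is its
  analogue for values in a complex normed space.\<close>

definition vector_holomorphic_on ::
    "(complex \<Rightarrow> 'a::complex_normed_vector) \<Rightarrow> complex set \<Rightarrow> bool"
  where "vector_holomorphic_on F U \<longleftrightarrow>
    (\<forall>z\<in>U. \<exists>F'. (F has_derivative (\<lambda>h. h *\<^sub>C F')) (at z within U))"

text \<open>The class $\mathcal{H}(\mathcal{L}(X))$; elements are functions on $(0,\infty)$, so only
  the values at \<open>t > 0\<close> are relevant.\<close>

definition analytic_families :: "(real \<Rightarrow> 'a::complex_banach \<Rightarrow>\<^sub>L 'a) set"
  where "analytic_families =
    {S. \<exists>\<phi> F. 0 < \<phi> \<and> \<phi> < pi \<and>
        (\<forall>z\<in>sector \<phi>. F z \<in> bounded_operators) \<and>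
        vector_holomorphic_on F (sector \<phi>) \<and>
        (\<exists>M \<omega>. \<forall>z\<in>sector \<phi>. norm (F z) \<le> M * exp (\<omega> * cmod z)) \<and>
        (\<forall>t>0. F (complex_of_real t) = S t)}"

text \<open>The infimum is taken in \<^typ>\<open>ereal\<close>, since it may be $-\infty$.\<close>

definition nonanalytic_growth_bound :: "(real \<Rightarrow> 'a::complex_banach \<Rightarrow>\<^sub>L 'a) \<Rightarrow> ereal"
  where "nonanalytic_growth_bound T =
    Inf (ereal ` {\<omega>. \<exists>S\<in>analytic_families.
      bdd_above ((\<lambda>t. exp (- \<omega> * t) * norm (T t - S t)) ` {0<..})})"

definition asymptotically_analytic :: "(real \<Rightarrow> 'a::complex_banach \<Rightarrow>\<^sub>L 'a) \<Rightarrow> bool"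
  where "asymptotically_analytic T \<longleftrightarrow> nonanalytic_growth_bound T < 0"

end

theory Submission
  imports Defs
begin

text \<open>
  Choose $\delta > 0$ and an analytic family $F$ with $\|T(t) - F(t)\| \le N e^{-\delta t}$.  It
  suffices to bound $F(t)$ for large $t$, and a bounded functional reduces this to a scalar
  function $f$ that is holomorphic on a cone around the positive half-line, where it grows at most
  exponentially.

  Cauchy's integral formula along the edges $\{s(1 \mp im) : s \ge 0\}$ of the cone, with the factor
  $e^{\lambda(t-z)}$ inserted to make the integrals converge, writes $2\pi i f(t)$ as a difference
  $\Phi_-(\lambda) - \Phi_+(\lambda)$ of two edge integrals for real $\lambda > w$, where $w$ is the
  growth rate of $f$.  The integral along the lower edge converges on a half-plane that contains
  $\lambda = a + iK$ for every $a > 0$, once $K$ is large; the one along the upper edge converges at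
  $a - iK$.  The derivative of either is $-e^{\lambda t}$ times the Laplace transform of $f$, taken
  along the respective edge.  By rotation of the contour and the identity theorem this transform is
  $r(\lambda) - q(\lambda)$ on the common domain with the right half-plane, where $r$ is the scalar
  resolvent function, which is holomorphic for $\mathrm{Re}\,\lambda > 0$, and $q$ is the Laplace
  transform of the exponentially decaying difference, so that $|q| \le N/\delta$.  Hence with a
  primitive $P$ of $e^{\lambda t}(r - q)$ on the right half-plane
  \[ 2\pi i f(t) = \Phi_-(a + iK) - \Phi_+(a - iK) + P(a + iK) - P(a - iK). \]
  The edge integrals are bounded by a constant times $e^{at}/t$, and the last difference by the length
  $2K$ of the segment times $e^{at}(\sup_{\mathrm{Re}\,\lambda = a} |r| + N/\delta)$.  The choice $a = 1/t$
  turns the resolvent bound into $g(t)$; this is \<open>growth_from_laplace_transform\<close>.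

  Two devices keep the proof elementary.  The scalar estimates are applied to
  $t \mapsto \ell(T(t + 1)x)$ instead of $\ell(T(t)x)$: the shift moves the vertex of the sector
  to $-1$, so that $f$ is holomorphic up to and beyond the vertex of the cone, and $g(t) \le g(t + 1)$ absorbs
  the loss.  And the exponential bound of $T$ is inherited from that of $F$ and the decay of
  $T - F$.
\<close>

section \<open>Norming functionals\<close>

definition sublinear :: "('a::real_normed_vector \<Rightarrow> real) \<Rightarrow> bool" where
  "sublinear p \<longleftrightarrow> (\<forall>x y. p (x + y) \<le> p x + p y) \<and> (\<forall>c x. c > 0 \<longrightarrow> p (c *\<^sub>R x) = c * p x)
     \<and> (\<forall>x. p x \<le> norm x)"

lemma sublinear_zero: "sublinear p \<Longrightarrow> p 0 = 0"
proof -
  assume p: "sublinear p"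
  have "p (2 *\<^sub>R 0) = 2 * p 0" using p unfolding sublinear_def by (metis zero_less_numeral)
  then show ?thesis by simp
qed

lemma sublinear_lower: assumes "sublinear p" shows "- norm x \<le> p x"
proof -
  have "p (x + (-x)) \<le> p x + p (-x)" "p (-x) \<le> norm (-x)"
    using assms unfolding sublinear_def by blast+
  then show ?thesis using sublinear_zero[OF assms] by simp
qed

lemma sublinear_add: "sublinear p \<Longrightarrow> p (x + y) \<le> p x + p y"
  and sublinear_scale: "sublinear p \<Longrightarrow> c > 0 \<Longrightarrow> p (c *\<^sub>R x) = c * p x"
  and sublinear_le_norm: "sublinear p \<Longrightarrow> p x \<le> norm x"
  unfolding sublinear_def by blast+

lemma sublinear_norm: "sublinear norm"
  by (auto simp: sublinear_def norm_triangle_ineq)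

text \<open>The largest sublinear minorant of $p$ whose value at $-y$ is at most $-p(y)$, that is, one
  for which $p(y)$ becomes the exact value in the direction $y$.\<close>

definition lower_along :: "('a::real_normed_vector \<Rightarrow> real) \<Rightarrow> 'a \<Rightarrow> 'a \<Rightarrow> real" where
  "lower_along p y x = (INF t\<in>{0..}. p (x + t *\<^sub>R y) - t * p y)"

lemma lower_along_bdd: assumes "sublinear p"
  shows "bdd_below ((\<lambda>t. p (x + t *\<^sub>R y) - t * p y) ` {0..})"
proof (rule bdd_belowI2)
  fix t :: real assume t: "t \<in> {0..}"
  have "t * p y = p (t *\<^sub>R y)"
    using sublinear_scale[OF assms, of t y] sublinear_zero[OF assms] t by (cases "t = 0") auto
  also have "\<dots> \<le> p (x + t *\<^sub>R y) + p (-x)"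
    using sublinear_add[OF assms, of "x + t *\<^sub>R y" "-x"] by simp
  finally show "- p (-x) \<le> p (x + t *\<^sub>R y) - t * p y" by simp
qed

lemma lower_along_le: assumes "sublinear p" "t \<ge> 0" shows "lower_along p y x \<le> p (x + t *\<^sub>R y) - t * p y"
  unfolding lower_along_def using assms by (intro cINF_lower lower_along_bdd) auto

lemma lower_along_le_self: "sublinear p \<Longrightarrow> lower_along p y x \<le> p x"
  using lower_along_le[of p 0 y x] by simp

lemma le_lower_along:
  assumes "\<And>t. t \<ge> 0 \<Longrightarrow> c \<le> p (x + t *\<^sub>R y) - t * p y"
  shows "c \<le> lower_along p y x"
  unfolding lower_along_def
proof (rule cINF_greatest)
  fix t :: real assume "t \<in> {0..}"
  then show "c \<le> p (x + t *\<^sub>R y) - t * p y" using assms[of t] by simp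
qed simp

text \<open>A sublinear $q$ satisfies $q(-y) \ge -q(y)$ always; lowering along $y$ forces equality, and so
  makes the functional odd at $y$.\<close>

lemma lower_along_uminus: assumes "sublinear p" shows "lower_along p y (- y) \<le> - p y"
proof -
  have "lower_along p y (- y) \<le> p (- y + 1 *\<^sub>R y) - 1 * p y"
    by (rule lower_along_le[OF assms]) simp
  then show ?thesis by (simp add: sublinear_zero[OF assms])
qed

lemma sublinear_lower_along: assumes p: "sublinear p" shows "sublinear (lower_along p y)"
  unfolding sublinear_def
proof (intro conjI allI impI)
  fix u v
  have *: "lower_along p y (u + v) - (p (v + t *\<^sub>R y) - t * p y) \<le> lower_along p y u" if t: "t \<ge> 0" for t
  proof (rule le_lower_along)
    fix s :: real assume s: "s \<ge> 0"
    have "lower_along p y (u + v) \<le> p ((u + v) + (s + t) *\<^sub>R y) - (s + t) * p y"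
      using s t by (intro lower_along_le p) auto
    also have "(u + v) + (s + t) *\<^sub>R y = (u + s *\<^sub>R y) + (v + t *\<^sub>R y)" by (simp add: algebra_simps)
    finally show "lower_along p y (u + v) - (p (v + t *\<^sub>R y) - t * p y) \<le> p (u + s *\<^sub>R y) - s * p y"
      using sublinear_add[OF p, of "u + s *\<^sub>R y" "v + t *\<^sub>R y"] by (simp add: algebra_simps)
  qed
  have "lower_along p y (u + v) - lower_along p y u \<le> lower_along p y v"
  proof (rule le_lower_along)
    fix t :: real assume "t \<ge> 0"
    from *[OF this] show "lower_along p y (u + v) - lower_along p y u \<le> p (v + t *\<^sub>R y) - t * p y" by linarith
  qed
  then show "lower_along p y (u + v) \<le> lower_along p y u + lower_along p y v" by simp
next
  fix c :: real and x assume c: "c > 0"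
  have ge: "c * lower_along p y x \<le> lower_along p y (c *\<^sub>R x)" if c: "c > 0" for c x
  proof (rule le_lower_along)
    fix t :: real assume t: "t \<ge> 0"
    have "c * lower_along p y x \<le> c * (p (x + (t / c) *\<^sub>R y) - (t / c) * p y)"
      using c t by (intro mult_left_mono lower_along_le p) auto
    also have "\<dots> = p (c *\<^sub>R (x + (t / c) *\<^sub>R y)) - t * p y"
      using sublinear_scale[OF p c, of "x + (t / c) *\<^sub>R y"] c by (simp add: right_diff_distrib)
    also have "c *\<^sub>R (x + (t / c) *\<^sub>R y) = c *\<^sub>R x + t *\<^sub>R y" using c by (simp add: algebra_simps)
    finally show "c * lower_along p y x \<le> p (c *\<^sub>R x + t *\<^sub>R y) - t * p y" .
  qed
  have "lower_along p y (c *\<^sub>R x) \<le> c * lower_along p y x"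
  proof -
    have "inverse c * lower_along p y (c *\<^sub>R x) \<le> lower_along p y x"
      using ge[of "inverse c" "c *\<^sub>R x"] c by simp
    then show ?thesis using c by (simp add: inverse_eq_divide pos_divide_le_eq mult.commute)
  qed
  with ge[OF c, of x] show "lower_along p y (c *\<^sub>R x) = c * lower_along p y x" by simp
next
  fix x show "lower_along p y x \<le> norm x"
    using lower_along_le_self[OF p, of y x] sublinear_le_norm[OF p, of x] by simp
qed

text \<open>A minimal element among the sublinear functionals below $p$, given by Zorn's lemma, cannot be lowered along
  any $y$, so it is odd, and an odd sublinear functional is linear.\<close>

lemma linear_minorant:
  assumes p: "sublinear (p :: 'a::real_normed_vector \<Rightarrow> real)"
  shows "\<exists>u. linear u \<and> (\<forall>x. u x \<le> p x)"
proof -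
  define A where "A = {q. sublinear q \<and> q \<le> p}"
  have pA: "p \<in> A" using p by (simp add: A_def)
  have "\<exists>m\<in>A. \<forall>a\<in>A. a \<le> m \<longrightarrow> a = m"
  proof (rule predicate_Zorn)
    show "partial_order_on A (relation_of (\<lambda>x y. y \<le> x) A)"
      by (rule partial_order_on_relation_ofI) auto
  next
    fix C assume C: "C \<in> Chains (relation_of (\<lambda>x y. y \<le> x) A)"
    have CA: "C \<subseteq> A" using C by (rule Chains_relation_of)
    have tot: "q \<le> q' \<or> q' \<le> q" if "q \<in> C" "q' \<in> C" for q q'
      using C that unfolding Chains_def relation_of_def by blast
    show "\<exists>u\<in>A. \<forall>a\<in>C. u \<le> a"
    proof (cases "C = {}")
      case True then show ?thesis using pA by auto
    next
      case False
      define u where "u x = (INF q\<in>C. q x)" for x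
      have sC: "sublinear q" if "q \<in> C" for q using CA that by (auto simp: A_def)
      have bdd: "bdd_below ((\<lambda>q. q x) ` C)" for x
        using sublinear_lower sC by (intro bdd_belowI2[where m = "- norm x"]) auto
      have ule: "u x \<le> q x" if "q \<in> C" for q x
        unfolding u_def using that by (intro cINF_lower bdd) auto
      have leu: "c \<le> u x" if "\<And>q. q \<in> C \<Longrightarrow> c \<le> q x" for c x
        unfolding u_def using that False by (intro cINF_greatest) auto
      have "sublinear u" unfolding sublinear_def
      proof (intro conjI allI impI)
        fix x y
        have *: "u (x + y) - q y \<le> u x" if q: "q \<in> C" for q
        proof (rule leu)
          fix q' assume q': "q' \<in> C"
          \<comment> \<open>Subadditivity of the infimum: of two members of the chain, the smaller one is below both.\<close>
          obtain q0 where q0: "q0 \<in> C" "q0 \<le> q" "q0 \<le> q'" using tot[OF q q'] q q' by auto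
          show "u (x + y) - q y \<le> q' x"
            using ule[OF q0(1), of "x + y"] sublinear_add[OF sC[OF q0(1)], of x y]
              le_funD[OF q0(2), of y] le_funD[OF q0(3), of x] by linarith
        qed
        have "u (x + y) - u x \<le> u y"
        proof (rule leu)
          fix q assume "q \<in> C"
          from *[OF this] show "u (x + y) - u x \<le> q y" by linarith
        qed
        then show "u (x + y) \<le> u x + u y" by simp
      next
        fix c :: real and x assume c: "c > 0"
        have ge: "c * u x \<le> u (c *\<^sub>R x)" if c: "c > 0" for c x
        proof (rule leu)
          fix q assume q: "q \<in> C"
          show "c * u x \<le> q (c *\<^sub>R x)"
            using ule[OF q, of x] c unfolding sublinear_scale[OF sC[OF q] c] by simp
        qed
        have "u (c *\<^sub>R x) \<le> c * u x"
        proof -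
          have "inverse c * u (c *\<^sub>R x) \<le> u x"
            using ge[of "inverse c" "c *\<^sub>R x"] c by simp
          then show ?thesis using c by (simp add: inverse_eq_divide pos_divide_le_eq mult.commute)
        qed
        with ge[OF c, of x] show "u (c *\<^sub>R x) = c * u x" by simp
      next
        fix x
        obtain q where "q \<in> C" using False by auto
        then show "u x \<le> norm x" using ule[of q x] sublinear_le_norm[OF sC, of q x] by simp
      qed
      moreover have "u \<le> p"
      proof (rule le_funI)
        fix x obtain q where q: "q \<in> C" using False by auto
        then have "q \<le> p" using CA by (auto simp: A_def)
        then show "u x \<le> p x" using ule[OF q, of x] by (meson le_funD order_trans)
      qed
      ultimately show ?thesis using ule by (auto simp: A_def le_fun_def)
    qed
  qed
  then obtain m where m: "m \<in> A" and min: "\<And>a. a \<in> A \<Longrightarrow> a \<le> m \<Longrightarrow> a = m" by blast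
  have sm: "sublinear m" and mp: "m \<le> p" using m by (auto simp: A_def)
  have "lower_along m y = m" for y
  proof (rule min)
    show le: "lower_along m y \<le> m" by (auto simp: le_fun_def lower_along_le_self sm)
    show "lower_along m y \<in> A" using sublinear_lower_along[OF sm] le mp by (auto simp: A_def)
  qed
  then have odd1: "m (- y) \<le> - m y" for y using lower_along_uminus[OF sm, of y] by simp
  have odd: "m (- y) = - m y" for y
    using odd1[of y] sublinear_add[OF sm, of y "-y"] sublinear_zero[OF sm] by simp
  have "linear m"
  proof (rule linearI)
    fix x y show "m (x + y) = m x + m y"
      using sublinear_add[OF sm, of x y] sublinear_add[OF sm, of "-x" "-y"] odd[of x] odd[of y] odd[of "x + y"]
      by simp
  next
    fix c :: real and x
    show "m (c *\<^sub>R x) = c *\<^sub>R m x"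
    proof (cases "c > 0 \<or> c = 0")
      case True then show ?thesis using sublinear_scale[OF sm] sublinear_zero[OF sm] by auto
    next
      case False
      then show ?thesis using sublinear_scale[OF sm, of "-c" x] odd[of "c *\<^sub>R x"] by simp
    qed
  qed
  then show ?thesis using mp by (auto simp: le_fun_def)
qed

text \<open>Lowering the norm along $x$ first forces a linear minorant $u$ of the result to have the value
  $\|x\|$ at $x$.  The complex functional is $y \mapsto u(y) - i\,u(iy)$.\<close>

lemma norming_functional:
  fixes x :: "'a::complex_normed_vector"
  obtains l :: "'a \<Rightarrow> complex"
  where "bounded_linear l" "\<And>c y. l (c *\<^sub>C y) = c * l y" "\<And>y. cmod (l y) \<le> norm y"
    "l x = complex_of_real (norm x)"
proof -
  obtain u where lin: "linear u" and le: "\<And>y. u y \<le> lower_along norm x y"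
    using linear_minorant[OF sublinear_lower_along[OF sublinear_norm]] by blast
  interpret u: linear u by (rule lin)
  have le_norm: "u y \<le> norm y" for y
    using le[of y] lower_along_le_self[OF sublinear_norm, of x y] by simp
  have abs_le: "\<bar>u y\<bar> \<le> norm y" for y
    using le_norm[of y] le_norm[of "- y"] by (simp add: u.neg)
  have ux: "u x = norm x"
    using le[of "- x"] lower_along_uminus[OF sublinear_norm, of x] le_norm[of x] by (simp add: u.neg)
  have R: "r *\<^sub>R y = complex_of_real r *\<^sub>C y" for r and y :: 'a by (simp add: scaleC_of_real)
  have uC: "u (complex_of_real r *\<^sub>C y) = r * u y" for r y
    by (simp add: scaleC_of_real u.scaleR)
  define l where "l y = Complex (u y) (- u (\<i> *\<^sub>C y))" for y
  have ladd: "l (y + z) = l y + l z" for y z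
    by (simp add: l_def complex_eq_iff u.add scaleC_add_right)
  have lC: "l (c *\<^sub>C y) = c * l y" for c y
  proof -
    have 1: "u (d *\<^sub>C z) = Re d * u z + Im d * u (\<i> *\<^sub>C z)" for d z
    proof -
      have "d = complex_of_real (Re d) + complex_of_real (Im d) * \<i>" by (simp add: complex_eq_iff)
      then have "d *\<^sub>C z = complex_of_real (Re d) *\<^sub>C z + complex_of_real (Im d) *\<^sub>C \<i> *\<^sub>C z"
        by (metis scaleC_add_left scaleC_scaleC)
      then show ?thesis by (simp add: u.add uC)
    qed
    have 2: "u (\<i> *\<^sub>C \<i> *\<^sub>C y) = - u y"
      using uC[of "-1" y] by (simp add: scaleC_scaleC)
    have 3: "\<i> *\<^sub>C c *\<^sub>C y = c *\<^sub>C \<i> *\<^sub>C y" by (simp add: scaleC_scaleC mult.commute)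
    show ?thesis by (simp add: l_def complex_eq_iff 3 1[of c y] 1[of c "\<i> *\<^sub>C y"] 2)
  qed
  have lle: "cmod (l y) \<le> norm y" for y
  proof -
    define c where "c = cnj (sgn (l y))"
    have "c * l y = complex_of_real (cmod (l y))"
    proof (cases "l y = 0")
      case False
      have "c * l y = cnj (l y) * l y / cmod (l y)"
        by (simp add: c_def sgn_eq)
      also have "cnj (l y) * l y = complex_of_real (cmod (l y)) * cmod (l y)"
        using complex_norm_square[of "l y"] by (simp add: power2_eq_square mult.commute)
      finally show ?thesis using False by simp
    qed (simp add: c_def)
    then have "cmod (l y) = Re (c * l y)" by simp
    also have "\<dots> = u (c *\<^sub>C y)" unfolding lC[symmetric] by (simp add: l_def)
    also have "\<dots> \<le> norm (c *\<^sub>C y)" by (rule le_norm)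
    also have "\<dots> \<le> norm y" by (simp add: norm_scaleC c_def norm_sgn)
    finally show ?thesis .
  qed
  have lR: "l (r *\<^sub>R y) = r *\<^sub>R l y" for r y
    by (simp add: R lC scaleR_conv_of_real)
  have "Re (l x) = norm x" by (simp add: l_def ux)
  moreover have "Im (l x) = 0"
  proof -
    have "(cmod (l x))\<^sup>2 \<le> (norm x)\<^sup>2" by (intro power_mono lle) simp
    then show ?thesis using \<open>Re (l x) = norm x\<close> by (simp add: cmod_power2)
  qed
  ultimately have "l x = complex_of_real (norm x)" by (simp add: complex_eq_iff)
  moreover have "bounded_linear l"
    by (rule bounded_linear_intro[where K = 1]) (simp_all add: ladd lR lle)
  ultimately show ?thesis using that lC lle by blast
qed

section \<open>Truncated and complete Laplace transforms\<close>

definition laplace_upto :: "real \<Rightarrow> (real \<Rightarrow> complex) \<Rightarrow> complex \<Rightarrow> complex" where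
  "laplace_upto R k z = integral {0..R} (\<lambda>s. exp (- z * of_real s) * k s)"

text \<open>Truncating at integers suffices, as all integrands considered decay exponentially; it makes the transform the
  limit of a sequence of entire functions.\<close>

definition laplace :: "(real \<Rightarrow> complex) \<Rightarrow> complex \<Rightarrow> complex" where
  "laplace k z = lim (\<lambda>n. laplace_upto (real n) k z)"

lemma laplace_eqI: "(\<lambda>n. laplace_upto (real n) k z) \<longlonglongrightarrow> v \<Longrightarrow> laplace k z = v"
  unfolding laplace_def by (rule limI)

lemma laplace_integrable:
  fixes k :: "real \<Rightarrow> complex"
  assumes "continuous_on {0..} k" "0 \<le> a"
  shows "(\<lambda>s. exp (- z * of_real s) * k s) integrable_on {a..b}"
  by (intro integrable_continuous_real continuous_intros continuous_on_subset[OF assms(1)])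
     (use assms(2) in auto)

lemma laplace_integral_bound:
  fixes k :: "real \<Rightarrow> complex"
  assumes k: "continuous_on {0..} k" and bd: "\<And>s. s \<ge> 0 \<Longrightarrow> cmod (k s) \<le> C * exp (c * s)"
    and e: "e > 0" "e \<le> Re z - c" and ab: "0 \<le> a" "a \<le> b"
  shows "cmod (integral {a..b} (\<lambda>s. exp (- z * of_real s) * k s)) \<le> C / e * exp (- e * a)"
proof -
  have C: "C \<ge> 0" using order_trans[OF norm_ge_zero bd[of 0]] by simp
  have I: "((\<lambda>s. C * exp (- e * s)) has_integral
      (- (C / e * exp (- e * b)) - (- (C / e * exp (- e * a))))) {a..b}"
    by (rule fundamental_theorem_of_calculus[OF ab(2)])
       (use e in \<open>auto intro!: derivative_eq_intros simp flip: has_real_derivative_iff_has_vector_derivative\<close>)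
  have "cmod (integral {a..b} (\<lambda>s. exp (- z * of_real s) * k s)) \<le> integral {a..b} (\<lambda>s. C * exp (- e * s))"
  proof (rule integral_norm_bound_integral)
    fix s assume s: "s \<in> {a..b}"
    have "cmod (exp (- z * of_real s) * k s) \<le> exp (- Re z * s) * (C * exp (c * s))"
      unfolding norm_mult using bd[of s] s ab by (intro mult_mono) auto
    also have "\<dots> = C * exp (- (Re z - c) * s)" by (simp add: algebra_simps flip: exp_add)
    also have "\<dots> \<le> C * exp (- e * s)"
      using mult_right_mono[OF e(2), of s] s ab C by (intro mult_left_mono) (auto simp: algebra_simps)
    finally show "cmod (exp (- z * of_real s) * k s) \<le> C * exp (- e * s)" .
  qed (rule laplace_integrable[OF k ab(1)], rule has_integral_integrable[OF I])
  also have "\<dots> = C / e * exp (- e * a) - C / e * exp (- e * b)"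
    unfolding integral_unique[OF I] by simp
  also have "\<dots> \<le> C / e * exp (- e * a)" using C e by simp
  finally show ?thesis .
qed

lemma laplace_upto_diff_bound:
  assumes k: "continuous_on {0..} k" and bd: "\<And>s. s \<ge> 0 \<Longrightarrow> cmod (k s) \<le> C * exp (c * s)"
    and e: "e > 0" "e \<le> Re z - c" and ab: "0 \<le> a" "a \<le> b"
  shows "cmod (laplace_upto b k z - laplace_upto a k z) \<le> C / e * exp (- e * a)"
proof -
  have "laplace_upto a k z + integral {a..b} (\<lambda>s. exp (- z * of_real s) * k s) = laplace_upto b k z"
    unfolding laplace_upto_def
    by (rule Henstock_Kurzweil_Integration.integral_combine[OF ab])
       (rule laplace_integrable[OF k order_refl])
  then have "laplace_upto b k z - laplace_upto a k z = integral {a..b} (\<lambda>s. exp (- z * of_real s) * k s)"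
    by (simp only: diff_eq_eq add.commute)
  then show ?thesis using laplace_integral_bound[OF assms] by simp
qed

lemma exp_decay_nat: "e > 0 \<Longrightarrow> (\<lambda>n. K * exp (- e * real n)) \<longlonglongrightarrow> 0"
  using tendsto_mult[OF tendsto_const[of K] LIMSEQ_power_zero[of "exp (- e)"]]
  by (simp add: exp_of_nat_mult[symmetric] mult.commute)

lemma laplace_tendsto:
  assumes k: "continuous_on {0..} k" and bd: "\<And>s. s \<ge> 0 \<Longrightarrow> cmod (k s) \<le> C * exp (c * s)"
    and z: "Re z > c"
  shows "(\<lambda>n. laplace_upto (real n) k z) \<longlonglongrightarrow> laplace k z"
proof -
  define e where "e = Re z - c"
  have e: "e > 0" "e \<le> Re z - c" using z by (auto simp: e_def)
  have "Cauchy (\<lambda>n. laplace_upto (real n) k z)"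
  proof (rule metric_CauchyI)
    fix \<epsilon> :: real assume "\<epsilon> > 0"
    then obtain N where N: "\<And>n. n \<ge> N \<Longrightarrow> C / e * exp (- e * real n) < \<epsilon>"
      using order_tendstoD(2)[OF exp_decay_nat[OF e(1), of "C / e"]]
      unfolding eventually_sequentially by blast
    have *: "dist (laplace_upto (real m) k z) (laplace_upto (real n) k z) < \<epsilon>" if "n \<ge> N" "m \<ge> n" for m n
      using laplace_upto_diff_bound[OF k bd e, of "real n" "real m"] N[OF that(1)] that(2)
      by (simp add: dist_norm)
    show "\<exists>M. \<forall>m\<ge>M. \<forall>n\<ge>M. dist (laplace_upto (real m) k z) (laplace_upto (real n) k z) < \<epsilon>"
      using * by (metis dist_commute linear)
  qed
  then show ?thesis unfolding laplace_def by (simp add: Cauchy_convergent_iff convergent_LIMSEQ_iff)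
qed

lemma laplace_minus_upto_bound:
  assumes k: "continuous_on {0..} k" and bd: "\<And>s. s \<ge> 0 \<Longrightarrow> cmod (k s) \<le> C * exp (c * s)"
    and e: "e > 0" "e \<le> Re z - c"
  shows "cmod (laplace k z - laplace_upto (real n) k z) \<le> C / e * exp (- e * real n)"
proof (rule Lim_norm_ubound)
  show "(\<lambda>m. laplace_upto (real m) k z - laplace_upto (real n) k z) \<longlonglongrightarrow>
      laplace k z - laplace_upto (real n) k z"
    using e by (intro tendsto_intros laplace_tendsto[OF k bd]) auto
  show "\<forall>\<^sub>F m in sequentially. cmod (laplace_upto (real m) k z - laplace_upto (real n) k z)
      \<le> C / e * exp (- e * real n)"
    using eventually_ge_at_top[of n]
    by eventually_elim (intro laplace_upto_diff_bound[OF k bd e], auto)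
qed auto

lemma laplace_bound:
  assumes k: "continuous_on {0..} k" and bd: "\<And>s. s \<ge> 0 \<Longrightarrow> cmod (k s) \<le> C * exp (c * s)"
    and z: "Re z > c"
  shows "cmod (laplace k z) \<le> C / (Re z - c)"
  using laplace_minus_upto_bound[OF k bd, of "Re z - c" z 0] z by (simp add: laplace_upto_def)

text \<open>Differentiation under the integral sign is permitted for the truncated transforms, and these converge
  locally uniformly; the convergence of the derivatives is then a consequence of holomorphy.\<close>

lemma laplace_moment:
  assumes k: "continuous_on {0..} k" and bd: "\<And>s. s \<ge> 0 \<Longrightarrow> cmod (k s) \<le> C * exp (c * s)"
    and z: "Re z > c"
  shows laplace_has_field_derivative:
      "(laplace k has_field_derivative - laplace (\<lambda>s. of_real s * k s) z) (at z)"
    and laplace_moment_tendsto: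
      "(\<lambda>n. laplace_upto (real n) (\<lambda>s. of_real s * k s) z) \<longlonglongrightarrow> laplace (\<lambda>s. of_real s * k s) z"
proof -
  define S where "S = {z. Re z > c}"
  have opS: "open S" unfolding S_def by (rule open_halfspace_Re_gt)
  have "\<exists>g'. \<forall>x\<in>S. (laplace k has_field_derivative g' x) (at x) \<and>
      (\<lambda>n. - laplace_upto (real n) (\<lambda>s. of_real s * k s) x) \<longlonglongrightarrow> g' x"
  proof (rule has_complex_derivative_uniform_sequence[OF opS])
    fix n x
    have kn: "continuous_on {0..real n} k" by (rule continuous_on_subset[OF k]) auto
    have "((\<lambda>x. integral (cbox 0 (real n)) (\<lambda>s. exp (- x * of_real s) * k s))
       has_field_derivative integral (cbox 0 (real n)) (\<lambda>s. - (exp (- x * of_real s) * (of_real s * k s))))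
       (at x within UNIV)"
    proof (rule leibniz_rule_field_derivative)
      show "continuous_on (UNIV \<times> cbox 0 (real n)) (\<lambda>(x, s). - (exp (- x * of_real s) * (of_real s * k s)))"
        unfolding split_def
        by (intro continuous_intros continuous_on_compose2[OF kn]) auto
      show "(\<lambda>s. exp (- x * of_real s) * k s) integrable_on cbox 0 (real n)" for x
        using laplace_integrable[OF k, of 0 x "real n"] by simp
      show "((\<lambda>x. exp (- x * of_real s) * k s) has_field_derivative - (exp (- x * of_real s) * (of_real s * k s)))
         (at x within UNIV)" for x s
        by (rule derivative_eq_intros refl | simp)+
    qed auto
    then show "(laplace_upto (real n) k has_field_derivative
        - laplace_upto (real n) (\<lambda>s. of_real s * k s) x) (at x)"
      by (simp add: laplace_upto_def[abs_def] integral_neg)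
  next
    fix x assume x: "x \<in> S"
    define d where "d = (Re x - c) / 2"
    have d: "d > 0" using x by (simp add: d_def S_def)
    have Re: "d \<le> Re y - c" if "y \<in> cball x d" for y
    proof -
      have "Re x - Re y \<le> d" using abs_Re_le_cmod[of "x - y"] that by (simp add: dist_norm)
      then show ?thesis by (simp add: d_def field_simps)
    qed
    have "uniform_limit (cball x d) (\<lambda>n. laplace_upto (real n) k) (laplace k) sequentially"
    proof (rule uniform_limitI)
      fix \<epsilon> :: real assume "\<epsilon> > 0"
      then have "\<forall>\<^sub>F n in sequentially. C / d * exp (- d * real n) < \<epsilon>"
        using order_tendstoD(2)[OF exp_decay_nat[OF d, of "C / d"]] by blast
      then show "\<forall>\<^sub>F n in sequentially. \<forall>y\<in>cball x d. dist (laplace_upto (real n) k y) (laplace k y) < \<epsilon>"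
      proof eventually_elim
        case (elim n)
        show ?case
        proof
          fix y assume y: "y \<in> cball x d"
          show "dist (laplace_upto (real n) k y) (laplace k y) < \<epsilon>"
            using laplace_minus_upto_bound[OF k bd d Re[OF y], of n] elim
            by (simp add: dist_norm norm_minus_commute)
        qed
      qed
    qed
    moreover have "cball x d \<subseteq> S"
    proof
      fix y assume "y \<in> cball x d"
      from Re[OF this] d show "y \<in> S" by (simp add: S_def)
    qed
    ultimately show "\<exists>d>0. cball x d \<subseteq> S \<and> uniform_limit (cball x d) (\<lambda>n. laplace_upto (real n) k) (laplace k) sequentially"
      using d by blast
  qed
  then obtain g' where g': "\<And>x. x \<in> S \<Longrightarrow> (laplace k has_field_derivative g' x) (at x)"
    "\<And>x. x \<in> S \<Longrightarrow> (\<lambda>n. - laplace_upto (real n) (\<lambda>s. of_real s * k s) x) \<longlonglongrightarrow> g' x" by blast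
  have zS: "z \<in> S" using z by (simp add: S_def)
  have lim: "(\<lambda>n. laplace_upto (real n) (\<lambda>s. of_real s * k s) z) \<longlonglongrightarrow> - g' z"
    using tendsto_minus[OF g'(2)[OF zS]] by simp
  show "(laplace k has_field_derivative - laplace (\<lambda>s. of_real s * k s) z) (at z)"
    using g'(1)[OF zS] laplace_eqI[OF lim] by simp
  show "(\<lambda>n. laplace_upto (real n) (\<lambda>s. of_real s * k s) z) \<longlonglongrightarrow> laplace (\<lambda>s. of_real s * k s) z"
    using lim laplace_eqI[OF lim] by simp
qed

lemma laplace_holomorphic:
  assumes k: "continuous_on {0..} k" and bd: "\<And>s. s \<ge> 0 \<Longrightarrow> cmod (k s) \<le> C * exp (c * s)"
  shows "laplace k holomorphic_on {z. Re z > c}"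
  unfolding holomorphic_on_def field_differentiable_def
  using laplace_has_field_derivative[OF assms] has_field_derivative_at_within by blast

lemma laplace_diff:
  assumes "continuous_on {0..} k" "\<And>s. s \<ge> 0 \<Longrightarrow> cmod (k s) \<le> C * exp (c * s)"
    and "continuous_on {0..} k'" "\<And>s. s \<ge> 0 \<Longrightarrow> cmod (k' s) \<le> C' * exp (c' * s)"
    and "Re z > c" "Re z > c'"
  shows "laplace (\<lambda>s. k s - k' s) z = laplace k z - laplace k' z"
proof (rule laplace_eqI)
  have "(\<lambda>n. laplace_upto (real n) k z - laplace_upto (real n) k' z) \<longlonglongrightarrow> laplace k z - laplace k' z"
    using assms by (intro tendsto_diff laplace_tendsto)
  also have "(\<lambda>n. laplace_upto (real n) k z - laplace_upto (real n) k' z) =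
      (\<lambda>n. laplace_upto (real n) (\<lambda>s. k s - k' s) z)"
    using laplace_integrable[OF assms(1) order_refl] laplace_integrable[OF assms(3) order_refl]
    by (simp add: laplace_upto_def right_diff_distrib integral_diff)
  finally show "(\<lambda>n. laplace_upto (real n) (\<lambda>s. k s - k' s) z) \<longlonglongrightarrow> laplace k z - laplace k' z" .
qed

section \<open>Functions holomorphic on a cone\<close>

lemma contour_integral_ray:
  assumes "R > 0"
  shows "contour_integral (linepath 0 (of_real R * b)) G = integral {0..R} (\<lambda>s. b * G (b * of_real s))"
proof -
  have "(\<lambda>x. x / R) ` {0..R} = {0..1}"
    using assms by (subst image_divide_atLeastAtMost) auto
  then have "integral {0..1} (\<lambda>x. b * G (b * of_real (R * x)))
      = (1 / \<bar>R\<bar>) *\<^sub>R integral {0..R} (\<lambda>s. b * G (b * of_real s))"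
    using integral_stretch_real[of R 0 R "\<lambda>s. b * G (b * of_real s)"] assms by simp
  then have "integral {0..R} (\<lambda>s. b * G (b * of_real s))
      = R *\<^sub>R integral {0..1} (\<lambda>x. b * G (b * of_real (R * x)))"
    using assms by simp
  also have "\<dots> = integral {0..1} (\<lambda>x. R *\<^sub>R (b * G (b * of_real (R * x))))"
    by (rule integral_cmul[symmetric])
  also have "\<dots> = contour_integral (linepath 0 (of_real R * b)) G"
    unfolding contour_integral_integral
    by (intro integral_cong) (simp add: linepath_def scaleR_conv_of_real mult_ac)
  finally show ?thesis ..
qed

lemma linear_times_exp_decay:
  assumes "e > 0" shows "(\<lambda>n. K * (real n * exp (- e * real n))) \<longlonglongrightarrow> 0"
proof -
  have "(\<lambda>n. real n * exp (- e * real n)) \<longlonglongrightarrow> 0" using assms by real_asymp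
  from tendsto_mult[OF tendsto_const[of K] this] show ?thesis by simp
qed

text \<open>The function is holomorphic on the cone with vertex $-1$ and slope $m$, whereas the contours stay in
  the closed cone with vertex $0$, which lies inside.\<close>

locale cone_function =
  fixes f :: "complex \<Rightarrow> complex" and m w M :: real
  assumes m: "0 < m" "m \<le> 1" and w: "w \<ge> 0"
    and holo: "f holomorphic_on {z. \<bar>Im z\<bar> < m * (Re z + 1)}"
    and growth: "\<And>z. \<bar>Im z\<bar> \<le> m * Re z \<Longrightarrow> cmod (f z) \<le> M * exp (w * Re z)"
begin

definition shifted_cone :: "complex set" where "shifted_cone = {z. \<bar>Im z\<bar> < m * (Re z + 1)}"

text \<open>Rays in the cone are parametrised by their real part.\<close>

definition direction :: "complex \<Rightarrow> bool" where "direction b \<longleftrightarrow> Re b = 1 \<and> \<bar>Im b\<bar> \<le> m"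

definition ray :: "complex \<Rightarrow> real \<Rightarrow> complex" where "ray b s = b * f (b * of_real s)"

lemma bound_nonneg: "M \<ge> 0"
  using growth[of 0] order_trans[OF norm_ge_zero[of "f 0"]] by fastforce

lemma shifted_cone_halfspaces: "shifted_cone = {z. Im z - m * Re z < m} \<inter> {z. - Im z - m * Re z < m}"
  by (auto simp: shifted_cone_def abs_less_iff algebra_simps)

lemma open_shifted_cone: "open shifted_cone"
  unfolding shifted_cone_halfspaces by (intro open_Int open_Collect_less continuous_intros)

lemma convex_shifted_cone: "convex shifted_cone"
proof -
  have "convex {z. Im z - m * Re z < m}" "convex {z. - Im z - m * Re z < m}"
    using convex_halfspace_lt[of "Complex (- m) 1" m] convex_halfspace_lt[of "Complex (- m) (-1)" m]
    by (simp_all add: inner_complex_def algebra_simps)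
  then show ?thesis unfolding shifted_cone_halfspaces by (rule convex_Int)
qed

lemma cone_in_shifted_cone: "\<bar>Im z\<bar> \<le> m * Re z \<Longrightarrow> z \<in> shifted_cone"
  using m by (simp add: shifted_cone_def algebra_simps)

lemma f_holo: "f holomorphic_on shifted_cone" using holo by (simp add: shifted_cone_def)

lemma direction_in_cone: "direction b \<Longrightarrow> s \<ge> 0 \<Longrightarrow> \<bar>Im (b * of_real s)\<bar> \<le> m * Re (b * of_real s)"
  by (auto simp: direction_def abs_mult mult_right_mono)

lemma direction_norm: "direction b \<Longrightarrow> cmod b \<le> 2"
  using cmod_le[of b] m by (simp add: direction_def)

lemma cont_along: assumes "direction b" shows "continuous_on {0..} (\<lambda>s. f (b * of_real s))"
proof (rule continuous_on_compose2[OF holomorphic_on_imp_continuous_on[OF f_holo]])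
  show "(\<lambda>s. b * complex_of_real s) ` {0..} \<subseteq> shifted_cone"
    using direction_in_cone[OF assms] cone_in_shifted_cone by auto
qed (intro continuous_intros)

lemma cont_ray: "direction b \<Longrightarrow> continuous_on {0..} (ray b)"
  unfolding ray_def by (intro continuous_intros cont_along)

lemma growth_along: "direction b \<Longrightarrow> s \<ge> 0 \<Longrightarrow> cmod (f (b * of_real s)) \<le> M * exp (w * s)"
  using growth[OF direction_in_cone[of b s]] by (simp add: direction_def)

lemma growth_ray: assumes "direction b" "s \<ge> 0" shows "cmod (ray b s) \<le> 2 * M * exp (w * s)"
  using mult_mono[OF direction_norm[OF assms(1)] growth_along[OF assms]] bound_nonneg
  by (simp add: ray_def norm_mult)

lemma direction_one: "direction 1" using m by (simp add: direction_def)

lemma segment_vertical: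
  assumes "direction b" "direction b'" and z: "z \<in> closed_segment (of_real R * b) (of_real R * b')" and R: "R \<ge> 0"
  shows "Re z = R" "\<bar>Im z\<bar> \<le> m * R"
proof -
  obtain u where u: "0 \<le> u" "u \<le> 1" and zu: "z = (1 - u) *\<^sub>R (of_real R * b) + u *\<^sub>R (of_real R * b')"
    using z unfolding closed_segment_def by blast
  define y where "y = (1 - u) * Im b + u * Im b'"
  have Re_z: "Re z = R" unfolding zu using assms(1,2) by (simp add: direction_def algebra_simps)
  then show "Re z = R" .
  have Im_z: "Im z = R * y" unfolding zu by (simp add: y_def algebra_simps)
  have "\<bar>y\<bar> \<le> (1 - u) * m + u * m"
    unfolding y_def using assms(1,2) u
    by (intro abs_triangle_ineq[THEN order_trans] add_mono) (auto simp: direction_def abs_mult mult_left_mono)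
  then have "\<bar>y\<bar> \<le> m" by (simp add: algebra_simps)
  then show "\<bar>Im z\<bar> \<le> m * R" unfolding Im_z using R by (simp add: abs_mult mult_left_mono mult.commute)
qed

lemma segment_vertical_Re:
  assumes z: "z \<in> closed_segment (of_real R * b) (of_real R * b')" and R: "R \<ge> 0"
  shows "min (Re (l * b)) (Re (l * b')) * R \<le> Re (l * z)"
proof -
  obtain u where u: "0 \<le> u" "u \<le> 1" and zu: "z = (1 - u) *\<^sub>R (of_real R * b) + u *\<^sub>R (of_real R * b')"
    using z unfolding closed_segment_def by blast
  have "min (Re (l * b)) (Re (l * b')) \<le> (1 - u) * Re (l * b) + u * Re (l * b')"
  proof -
    have "(1 - u) * min (Re (l * b)) (Re (l * b')) + u * min (Re (l * b)) (Re (l * b'))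
       \<le> (1 - u) * Re (l * b) + u * Re (l * b')"
      using u by (intro add_mono mult_left_mono) auto
    then show ?thesis by (simp add: algebra_simps)
  qed
  then have "min (Re (l * b)) (Re (l * b')) * R \<le> ((1 - u) * Re (l * b) + u * Re (l * b')) * R"
    using R by (rule mult_right_mono)
  also have "\<dots> = Re (l * z)" by (simp add: zu algebra_simps)
  finally show "min (Re (l * b)) (Re (l * b')) * R \<le> Re (l * z)" .
qed

lemma closed_segment_shifted_cone:
  assumes "x \<in> shifted_cone" "y \<in> shifted_cone" shows "closed_segment x y \<subseteq> shifted_cone"
  using convex_contains_segment[of shifted_cone] convex_shifted_cone assms by blast

text \<open>Cauchy's theorem for the triangle with corners $0$, $n$, $nb$.  On its third side
  $\mathrm{Re}(\lambda z)$ is a convex combination of the values at the two corners, hence the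
  integrand decays exponentially in $n$ as soon as it does so along both rays.\<close>

lemma laplace_rotate:
  assumes b: "direction b" and l: "Re l > w" "Re (l * b) > w"
  shows "laplace (ray b) (l * b) = laplace (ray 1) l"
proof -
  define G where "G z = exp (- l * z) * f z" for z
  define e where "e = min (Re l) (Re (l * b)) - w"
  have e: "e > 0" using l by (simp add: e_def)
  have Gh: "G holomorphic_on shifted_cone" unfolding G_def by (intro holomorphic_intros f_holo)
  have ray_int: "contour_integral (linepath 0 (of_real (real n) * c)) G = laplace_upto (real n) (ray c) (l * c)"
    if "n \<ge> 1" for n c
    using that contour_integral_ray[of "real n" c G]
    by (simp add: laplace_upto_def G_def ray_def mult_ac)
  have bound: "cmod (laplace_upto (real n) (ray b) (l * b) - laplace_upto (real n) (ray 1) l)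
      \<le> M * m * (real n * exp (- e * real n))" if n: "n \<ge> 1" for n
  proof -
    let ?p = "of_real (real n) * 1 :: complex" and ?q = "of_real (real n) * b"
    have corners: "0 \<in> shifted_cone" "?p \<in> shifted_cone" "?q \<in> shifted_cone"
      using cone_in_shifted_cone[OF direction_in_cone[OF b, of "real n"]] cone_in_shifted_cone[OF direction_in_cone[OF direction_one, of "real n"]] m
      by (simp_all add: mult.commute shifted_cone_def)
    have cont: "continuous_on (closed_segment x y) G" if "x \<in> shifted_cone" "y \<in> shifted_cone" for x y
      using holomorphic_on_imp_continuous_on[OF Gh] closed_segment_shifted_cone[OF that] continuous_on_subset by blast
    have "convex hull {0, ?p, ?q} \<subseteq> shifted_cone" using corners convex_shifted_cone by (intro hull_minimal) auto
    then have "G holomorphic_on (convex hull {0, ?p, ?q})" using Gh holomorphic_on_subset by blast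
    from has_chain_integral_chain_integral3[OF Cauchy_theorem_triangle[OF this]]
    have "contour_integral (linepath 0 ?p) G + contour_integral (linepath ?p ?q) G
        + contour_integral (linepath ?q 0) G = 0" .
    moreover have "contour_integral (linepath ?q 0) G = - contour_integral (linepath 0 ?q) G"
      using contour_integral_reverse_linepath[OF cont[OF corners(3,1)]] .
    ultimately have "laplace_upto (real n) (ray b) (l * b) - laplace_upto (real n) (ray 1) l
        = contour_integral (linepath ?p ?q) G"
      using ray_int[OF n, of b] ray_int[OF n, of 1] by (simp add: algebra_simps)
    also have "cmod \<dots> \<le> (M * exp (- e * real n)) * cmod (?q - ?p)"
    proof (rule contour_integral_bound_linepath)
      show "G contour_integrable_on linepath ?p ?q"
        by (rule contour_integrable_continuous_linepath[OF cont[OF corners(2,3)]])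
      show "0 \<le> M * exp (- e * real n)" using bound_nonneg by simp
      fix z assume z: "z \<in> closed_segment ?p ?q"
      note sv = segment_vertical[OF direction_one b z] segment_vertical_Re[OF z, of l]
      have "cmod (G z) \<le> exp (- Re (l * z)) * (M * exp (w * Re z))"
        unfolding G_def norm_mult using sv growth[of z] by (intro mult_mono) auto
      also have "\<dots> = M * exp (w * real n - Re (l * z))"
        by (simp only: exp_diff exp_minus divide_inverse mult_ac sv(1))
      also have "\<dots> \<le> M * exp (- e * real n)"
        using sv bound_nonneg by (intro mult_left_mono) (auto simp: e_def algebra_simps)
      finally show "cmod (G z) \<le> M * exp (- e * real n)" .
    qed
    also have "\<dots> \<le> (M * exp (- e * real n)) * (real n * m)"
    proof (rule mult_left_mono)
      have "?q - ?p = of_real (real n) * (\<i> * of_real (Im b))"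
        using b by (simp add: complex_eq_iff direction_def)
      then show "cmod (?q - ?p) \<le> real n * m" using b by (simp add: norm_mult direction_def mult_left_mono)
    qed (use bound_nonneg in simp)
    finally show ?thesis by (simp add: mult_ac)
  qed
  have "(\<lambda>n. laplace_upto (real n) (ray b) (l * b) - laplace_upto (real n) (ray 1) l) \<longlonglongrightarrow> 0"
  proof (rule Lim_null_comparison)
    show "\<forall>\<^sub>F n in sequentially. cmod (laplace_upto (real n) (ray b) (l * b) - laplace_upto (real n) (ray 1) l)
        \<le> M * m * (real n * exp (- e * real n))"
      using eventually_ge_at_top[of 1] by eventually_elim (rule bound)
  qed (rule linear_times_exp_decay[OF e])
  moreover have "(\<lambda>n. laplace_upto (real n) (ray b) (l * b) - laplace_upto (real n) (ray 1) l)
      \<longlonglongrightarrow> laplace (ray b) (l * b) - laplace (ray 1) l"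
    by (intro tendsto_diff laplace_tendsto[OF cont_ray growth_ray] b direction_one l)
  ultimately have "laplace (ray b) (l * b) - laplace (ray 1) l = 0" using LIMSEQ_unique by blast
  then show ?thesis by simp
qed

definition cauchy_kernel :: "real \<Rightarrow> complex \<Rightarrow> real \<Rightarrow> complex" where
  "cauchy_kernel t b s = ray b s / (b * of_real s - of_real t)"

definition edge :: "complex \<Rightarrow> bool" where "edge b \<longleftrightarrow> Re b = 1 \<and> \<bar>Im b\<bar> = m"

lemma edge_direction: "edge b \<Longrightarrow> direction b" by (simp add: edge_def direction_def)

lemma edge_distance:
  assumes "edge b" "s \<ge> 0" "t > 0"
  shows "m * t / 2 \<le> cmod (b * of_real s - of_real t)"
proof (cases "s \<le> t / 2")
  case True
  have "m * t / 2 \<le> t / 2" using m assms(3) by simp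
  also have "\<dots> \<le> \<bar>Re (b * of_real s - of_real t)\<bar>" using True assms by (simp add: edge_def)
  also have "\<dots> \<le> cmod (b * of_real s - of_real t)" by (rule abs_Re_le_cmod)
  finally show ?thesis .
next
  case False
  have "m * t / 2 \<le> m * s" using m False by (simp add: field_simps)
  also have "\<dots> = \<bar>Im (b * of_real s - of_real t)\<bar>" using assms by (simp add: edge_def abs_mult)
  also have "\<dots> \<le> cmod (b * of_real s - of_real t)" by (rule abs_Im_le_cmod)
  finally show ?thesis .
qed

lemma edge_nonzero: "edge b \<Longrightarrow> s \<ge> 0 \<Longrightarrow> t > 0 \<Longrightarrow> b * of_real s - of_real t \<noteq> 0"
  using edge_distance[of b s t] m mult_pos_pos[of m t] by (metis half_gt_zero_iff not_less norm_zero)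

lemma cont_cauchy_kernel: "edge b \<Longrightarrow> t > 0 \<Longrightarrow> continuous_on {0..} (cauchy_kernel t b)"
  unfolding cauchy_kernel_def
  by (intro continuous_intros cont_ray edge_direction) (use edge_nonzero in auto)

lemma growth_cauchy_kernel:
  assumes "edge b" "t > 0" "s \<ge> 0"
  shows "cmod (cauchy_kernel t b s) \<le> 4 * M / (m * t) * exp (w * s)"
proof -
  have "cmod (cauchy_kernel t b s) \<le> (2 * M * exp (w * s)) / (m * t / 2)"
    unfolding cauchy_kernel_def norm_divide
    using growth_ray[OF edge_direction[OF assms(1)] assms(3)] edge_distance[OF assms(1,3,2)] m assms(2) bound_nonneg
    by (intro frac_le) auto
  then show ?thesis by (simp add: field_simps)
qed

lemma Re_edge: "edge b \<Longrightarrow> Re (of_real L * b) = L" by (simp add: edge_def)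

text \<open>Every point of the open truncated cone is a convex combination of the corners, and an open subset
  of the triangle lies in its interior.\<close>

lemma triangle_interior:
  assumes "0 < t" "t < R"
  shows "of_real t \<in> interior (convex hull {0, of_real R * Complex 1 (- m), of_real R * Complex 1 m})"
proof -
  let ?H = "convex hull {0, of_real R * Complex 1 (- m), of_real R * Complex 1 m}"
  let ?O = "{z. Re z < R} \<inter> {z. Im z < m * Re z} \<inter> {z. - Im z < m * Re z}"
  have "?O \<subseteq> ?H"
  proof
    fix z assume z: "z \<in> ?O"
    define p where "p = Re z / (2 * R)"
    define q where "q = Im z / (2 * (R * m))"
    have R: "R > 0" using assms by simp
    have pq: "\<bar>q\<bar> \<le> p"
      using z R m by (auto simp: p_def q_def field_simps abs_le_iff)
    have "z = (1 - 2 * p) *\<^sub>R 0 + (p - q) *\<^sub>R (of_real R * Complex 1 (- m))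
        + (p + q) *\<^sub>R (of_real R * Complex 1 m)"
      using R m by (simp add: complex_eq_iff p_def q_def field_simps)
    moreover have "1 - 2 * p \<ge> 0" using z R by (simp add: p_def)
    ultimately show "z \<in> ?H" unfolding convex_hull_3
      using pq by (intro CollectI exI[of _ "1 - 2 * p"] exI[of _ "p - q"] exI[of _ "p + q"]) (auto simp: abs_le_iff)
  qed
  moreover have "open ?O" by (intro open_Int open_Collect_less continuous_intros)
  ultimately have "?O \<subseteq> interior ?H" by (rule interior_maximal)
  then show ?thesis using assms m by auto
qed

text \<open>Cauchy's integral formula for the triangle whose corners are $0$ and the points of the two edges with
  real part $n$; the contribution of the vertical side vanishes as $n \to \infty$.\<close>

lemma cauchy_formula_edges:
  assumes t: "t > 0" and L: "L > w"
  shows "exp (of_real (L * t)) * (laplace (cauchy_kernel t (Complex 1 (- m))) (of_real L * Complex 1 (- m))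
     - laplace (cauchy_kernel t (Complex 1 m)) (of_real L * Complex 1 m)) = 2 * of_real pi * \<i> * f (of_real t)"
proof -
  define b where "b = Complex 1 (- m)"
  define b' where "b' = Complex 1 m"
  have b: "edge b" and b': "edge b'" using m by (auto simp: edge_def b_def b'_def)
  define H where "H z = f z * exp (of_real L * (of_real t - z))" for z
  define G where "G z = H z / (z - of_real t)" for z
  define E where "E = exp (complex_of_real (L * t))"
  have Hh: "H holomorphic_on shifted_cone" unfolding H_def by (intro holomorphic_intros f_holo)
  have Gc: "continuous_on (shifted_cone - {of_real t}) G"
    unfolding G_def using holomorphic_on_imp_continuous_on[OF Hh]
    by (intro continuous_intros) (auto intro: continuous_on_subset)
  have ray_int: "contour_integral (linepath 0 (of_real (real n) * c)) G
      = E * laplace_upto (real n) (cauchy_kernel t c) (of_real L * c)" if "n \<ge> 1" "edge c" for n c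
  proof -
    have "contour_integral (linepath 0 (of_real (real n) * c)) G
        = integral {0..real n} (\<lambda>s. E * (exp (- (of_real L * c) * of_real s) * cauchy_kernel t c s))"
      using that contour_integral_ray[of "real n" c G]
      by (simp add: G_def H_def cauchy_kernel_def ray_def E_def exp_diff exp_minus field_simps)
    also have "\<dots> = E * laplace_upto (real n) (cauchy_kernel t c) (of_real L * c)"
      unfolding laplace_upto_def by (rule integral_mult_right)
    finally show ?thesis .
  qed
  define e where "e = L - w"
  have e: "e > 0" using L by (simp add: e_def)
  define D where "D n = E * laplace_upto (real n) (cauchy_kernel t b) (of_real L * b)
       - E * laplace_upto (real n) (cauchy_kernel t b') (of_real L * b')" for n
  have bound: "cmod (D n - 2 * of_real pi * \<i> * f (of_real t)) \<le> (M * exp (L * t) * 2 * m) * (real n * exp (- e * real n))"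
    if n: "real n \<ge> t + 1" for n
  proof -
    have n1: "n \<ge> 1" using n t by simp
    let ?p = "of_real (real n) * b" and ?q = "of_real (real n) * b'"
    have corners: "0 \<in> shifted_cone" "?p \<in> shifted_cone" "?q \<in> shifted_cone" "of_real t \<in> shifted_cone"
      using cone_in_shifted_cone[OF direction_in_cone[OF edge_direction[OF b], of "real n"]]
        cone_in_shifted_cone[OF direction_in_cone[OF edge_direction[OF b'], of "real n"]] m t
      by (simp_all add: mult.commute shifted_cone_def)
    let ?g = "linepath 0 ?p +++ linepath ?p ?q +++ linepath ?q 0"
    have int: "of_real t \<in> interior (convex hull {0, ?p, ?q})"
      using triangle_interior[of t "real n"] t n by (simp add: b_def b'_def)
    then have nt: "of_real t \<notin> closed_segment 0 ?p" "of_real t \<notin> closed_segment ?p ?q"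
        "of_real t \<notin> closed_segment ?q 0"
      using interior_of_triangle[of 0 ?p ?q] by auto
    have sub: "closed_segment 0 ?p \<subseteq> shifted_cone - {of_real t}" "closed_segment ?p ?q \<subseteq> shifted_cone - {of_real t}"
        "closed_segment ?q 0 \<subseteq> shifted_cone - {of_real t}"
      using nt closed_segment_shifted_cone corners by auto
    have "winding_number ?g (of_real t) = 1"
      unfolding winding_number_triangle[OF int] using n1 m t by (auto simp: b_def)
    moreover have "((\<lambda>z. H z / (z - of_real t)) has_contour_integral
        (2 * pi * \<i> * winding_number ?g (of_real t) * H (of_real t))) ?g"
    proof (rule Cauchy_integral_formula_convex_simple[OF convex_shifted_cone Hh])
      show "path_image ?g \<subseteq> shifted_cone - {of_real t}" using sub by (auto simp: path_image_join)
    qed (use corners open_shifted_cone in \<open>auto simp: interior_open intro!: valid_path_join\<close>)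
    ultimately have "(G has_contour_integral (2 * of_real pi * \<i> * f (of_real t))) ?g"
      by (simp add: G_def[abs_def] H_def)
    from has_chain_integral_chain_integral3[OF this]
    have "contour_integral (linepath 0 ?p) G + contour_integral (linepath ?p ?q) G
        + contour_integral (linepath ?q 0) G = 2 * of_real pi * \<i> * f (of_real t)" .
    moreover have "contour_integral (linepath ?q 0) G = - contour_integral (linepath 0 ?q) G"
      using contour_integral_reverse_linepath[OF continuous_on_subset[OF Gc sub(3)]] .
    ultimately have "D n - 2 * of_real pi * \<i> * f (of_real t) = - contour_integral (linepath ?p ?q) G"
      unfolding D_def using ray_int[OF n1 b] ray_int[OF n1 b'] by (simp add: algebra_simps)
    then have "cmod (D n - 2 * of_real pi * \<i> * f (of_real t)) = cmod (contour_integral (linepath ?p ?q) G)"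
      by simp
    also have "\<dots> \<le> (M * exp (L * t) * exp (- e * real n)) * cmod (?q - ?p)"
    proof (rule contour_integral_bound_linepath)
      show "G contour_integrable_on linepath ?p ?q"
        by (rule contour_integrable_continuous_linepath[OF continuous_on_subset[OF Gc sub(2)]])
      show "0 \<le> M * exp (L * t) * exp (- e * real n)" using bound_nonneg by simp
      fix z assume z: "z \<in> closed_segment ?p ?q"
      note sv = segment_vertical[OF edge_direction[OF b] edge_direction[OF b'] z]
      have "1 \<le> Re (z - of_real t)" using sv n by simp
      then have ge: "1 \<le> cmod (z - of_real t)" using complex_Re_le_cmod order_trans by blast
      have "cmod (G z) \<le> cmod (H z) / 1"
        unfolding G_def norm_divide using ge by (intro divide_left_mono) (auto intro: mult_pos_pos)
      also have "\<dots> \<le> (M * exp (w * Re z)) * exp (L * (t - Re z))"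
        unfolding H_def norm_mult using sv growth[of z] bound_nonneg by (simp add: mult_right_mono)
      also have "\<dots> = M * exp (L * t) * exp (- e * real n)"
        using sv by (simp add: e_def algebra_simps flip: exp_add)
      finally show "cmod (G z) \<le> M * exp (L * t) * exp (- e * real n)" .
    qed
    also have "cmod (?q - ?p) = 2 * m * real n"
    proof -
      have "?q - ?p = of_real (2 * m * real n) * \<i>"
        by (simp add: complex_eq_iff b_def b'_def)
      then show ?thesis using m by (simp add: norm_mult)
    qed
    finally show ?thesis by (simp add: mult_ac)
  qed
  have "(\<lambda>n. D n - 2 * of_real pi * \<i> * f (of_real t)) \<longlonglongrightarrow> 0"
  proof (rule Lim_null_comparison)
    have "\<forall>\<^sub>F n in sequentially. real n \<ge> t + 1" by real_asymp
    then show "\<forall>\<^sub>F n in sequentially. cmod (D n - 2 * of_real pi * \<i> * f (of_real t))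
        \<le> (M * exp (L * t) * 2 * m) * (real n * exp (- e * real n))"
      by eventually_elim (rule bound)
  qed (rule linear_times_exp_decay[OF e])
  moreover have "(\<lambda>n. D n - 2 * of_real pi * \<i> * f (of_real t)) \<longlonglongrightarrow>
      (E * laplace (cauchy_kernel t b) (of_real L * b) - E * laplace (cauchy_kernel t b') (of_real L * b')) - 2 * of_real pi * \<i> * f (of_real t)"
    unfolding D_def
    by (intro tendsto_intros laplace_tendsto[OF cont_cauchy_kernel growth_cauchy_kernel] b b' t;
        simp only: Re_edge[OF b] Re_edge[OF b'] L)
  ultimately have "(E * laplace (cauchy_kernel t b) (of_real L * b) - E * laplace (cauchy_kernel t b') (of_real L * b'))
      - 2 * of_real pi * \<i> * f (of_real t) = 0" using LIMSEQ_unique by blast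
  then show ?thesis by (simp add: b_def b'_def E_def right_diff_distrib)
qed

text \<open>The integral of $f(z)\,e^{\lambda(t-z)}/(z-t)$ along the ray through $b$, as a function of
  $\lambda$.\<close>

definition edge_integral :: "real \<Rightarrow> complex \<Rightarrow> complex \<Rightarrow> complex" where
  "edge_integral t b l = exp (l * of_real t) * laplace (cauchy_kernel t b) (l * b)"

text \<open>Differentiating $e^{\lambda(t-z)}$ in $\lambda$ cancels the pole at $t$ and leaves the Laplace
  transform of $f$ along the ray.\<close>

lemma edge_integral_derivative:
  assumes b: "edge b" and t: "t > 0" and l: "Re (l * b) > w"
  shows "(edge_integral t b has_field_derivative - (exp (l * of_real t) * laplace (ray b) (l * b))) (at l)"
proof -
  note K = cont_cauchy_kernel[OF b t] growth_cauchy_kernel[OF b t] l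
  let ?k = "cauchy_kernel t b" and ?k1 = "\<lambda>s. of_real s * cauchy_kernel t b s"
  have eq: "ray b s = b * ?k1 s - of_real t * ?k s" if "s \<ge> 0" for s
  proof -
    have "b * ?k1 s - of_real t * ?k s = (b * of_real s - of_real t) * cauchy_kernel t b s"
      by (simp add: algebra_simps)
    then show ?thesis using edge_nonzero[OF b that t] by (simp add: cauchy_kernel_def)
  qed
  have int: "(\<lambda>s. exp (- (l * b) * of_real s) * ?k s) integrable_on {0..x}"
      "(\<lambda>s. exp (- (l * b) * of_real s) * ?k1 s) integrable_on {0..x}" for x
    by (intro laplace_integrable continuous_intros cont_cauchy_kernel b t order_refl)+
  have "laplace_upto x (ray b) (l * b) = b * laplace_upto x ?k1 (l * b) - of_real t * laplace_upto x ?k (l * b)" for x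
  proof -
    have "laplace_upto x (ray b) (l * b) = integral {0..x}
        (\<lambda>s. b * (exp (- (l * b) * of_real s) * ?k1 s) - of_real t * (exp (- (l * b) * of_real s) * ?k s))"
      unfolding laplace_upto_def by (intro integral_cong) (auto simp: eq algebra_simps)
    also have "\<dots> = integral {0..x} (\<lambda>s. b * (exp (- (l * b) * of_real s) * ?k1 s))
        - integral {0..x} (\<lambda>s. of_real t * (exp (- (l * b) * of_real s) * ?k s))"
      by (intro integral_diff integrable_on_mult_right int)
    finally show ?thesis unfolding laplace_upto_def integral_mult_right .
  qed
  then have L: "laplace (ray b) (l * b) = b * laplace ?k1 (l * b) - of_real t * laplace ?k (l * b)"
    by (intro laplace_eqI)
      (simp, intro tendsto_intros laplace_tendsto[OF K] laplace_moment_tendsto[OF K])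
  have D: "(laplace ?k has_field_derivative - laplace ?k1 (l * b)) (at (l * b))"
    by (rule laplace_has_field_derivative[OF K])
  have "((\<lambda>l. laplace ?k (l * b)) has_field_derivative - laplace ?k1 (l * b) * b) (at l)"
    by (rule DERIV_chain2[where f = "laplace ?k" and g = "\<lambda>l. l * b", OF D])
      (auto intro!: derivative_eq_intros)
  then have der: "(edge_integral t b has_field_derivative
      of_real t * exp (l * of_real t) * laplace ?k (l * b) + exp (l * of_real t) * (- laplace ?k1 (l * b) * b)) (at l)"
    unfolding edge_integral_def[abs_def] by (auto intro!: derivative_eq_intros)
  show ?thesis unfolding L by (rule DERIV_cong[OF der]) (simp add: algebra_simps)
qed

lemma edge_integral_bound:
  assumes b: "edge b" and t: "t > 0" and l: "Re (l * b) \<ge> w + 1"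
  shows "cmod (edge_integral t b l) \<le> exp (Re l * t) * (4 * M / (m * t))"
proof -
  have "cmod (laplace (cauchy_kernel t b) (l * b)) \<le> 4 * M / (m * t) / (Re (l * b) - w)"
    using l by (intro laplace_bound[OF cont_cauchy_kernel growth_cauchy_kernel] b t) auto
  also have "\<dots> \<le> 4 * M / (m * t) / 1"
    using l bound_nonneg m t by (intro divide_left_mono) auto
  finally have "exp (Re l * t) * cmod (laplace (cauchy_kernel t b) (l * b)) \<le> exp (Re l * t) * (4 * M / (m * t))"
    by (intro mult_left_mono) auto
  then show ?thesis by (simp add: edge_integral_def norm_mult)
qed

lemma convex_halfplane: "convex {l. Re (l * b) > c}"
  using convex_halfspace_gt[of c "cnj b"] by (simp add: inner_complex_def mult.commute)

lemma open_halfplane: "open {l. Re (l * b) > c}"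
  by (intro open_Collect_less continuous_intros)

text \<open>The quantitative heart of the proof.  The constants on the right depend on $t$ and $a$ only as
  displayed, and linearly on $M$, $N$ and $B$; this uniformity allows the passage from scalar functions back
  to operator norms.\<close>

lemma growth_from_laplace_transform:
  assumes h: "continuous_on {0..} h"
    and hf: "\<And>s. s \<ge> 0 \<Longrightarrow> cmod (h s - f (of_real s)) \<le> N * exp (- \<delta> * s)" and \<delta>: "\<delta> > 0"
    and r: "r holomorphic_on {l. Re l > 0}"
    and rh: "\<And>l. Re l > w \<Longrightarrow> r l = laplace h l"
    and t: "t > 0" and a: "a > 0" and B: "\<And>l. Re l = a \<Longrightarrow> cmod (r l) \<le> B"
  shows "2 * pi * cmod (f (of_real t)) \<le> exp (a * t) * (8 * M / (m * t) + 2 * ((w + 1) / m) * (B + N / \<delta>))"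
proof -
  \<comment> \<open>At height $K$ the edge integrals involve transforms at real part $a + mK = a + w + 1$, beyond the growth rate $w$.\<close>
  define K where "K = (w + 1) / m"
  have K: "K > 0" using w m by (simp add: K_def)
  have N: "N \<ge> 0" using order_trans[OF norm_ge_zero hf[of 0]] by simp
  define p where "p s = h s - ray 1 s" for s
  have p: "continuous_on {0..} p" unfolding p_def by (intro continuous_intros h cont_ray direction_one)
  have pb: "cmod (p s) \<le> N * exp ((- \<delta>) * s)" if "s \<ge> 0" for s
    using hf[OF that] by (simp add: p_def ray_def)
  have hb: "cmod (h s) \<le> (2 * M + N) * exp (w * s)" if s: "s \<ge> 0" for s
  proof -
    have "cmod (h s) \<le> cmod (ray 1 s) + cmod (p s)"
      unfolding p_def by (metis add.commute diff_add_cancel norm_triangle_ineq)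
    also have "\<dots> \<le> 2 * M * exp (w * s) + N * exp ((- \<delta>) * s)"
      by (intro add_mono growth_ray direction_one s pb)
    also have "N * exp ((- \<delta>) * s) \<le> N * exp (w * s)"
      using s w \<delta> N mult_right_mono[of "- \<delta>" w s] by (intro mult_left_mono) auto
    finally show ?thesis by (simp add: algebra_simps)
  qed
  \<comment> \<open>The multiplication by one gives both factors the shape of the half-plane lemmas.\<close>
  define U where "U b = {l. Re (l * 1) > 0} \<inter> {l. Re (l * b) > w}" for b
  define q where "q l = r l - laplace p l" for l
  have ph: "laplace p holomorphic_on {l. Re l > 0}"
    by (rule holomorphic_on_subset[OF laplace_holomorphic[OF p pb]]) (use \<delta> in auto)
  have qh: "q holomorphic_on {l. Re l > 0}"
    unfolding q_def by (intro holomorphic_intros r ph)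
  have qB: "cmod (q l) \<le> B + N / \<delta>" if "Re l = a" for l
  proof -
    have "cmod (laplace p l) \<le> N / (Re l - (- \<delta>))"
      by (rule laplace_bound[OF p pb]) (use a \<delta> that in auto)
    also have "\<dots> \<le> N / \<delta>" using N a \<delta> that by (intro divide_left_mono) auto
    finally show ?thesis unfolding q_def using B[OF that] norm_triangle_ineq4[of "r l" "laplace p l"] by linarith
  qed
  \<comment> \<open>Rotation gives the equation where both real parts exceed $w$, and the identity theorem extends it.\<close>
  have q_ray: "laplace (ray b) (l * b) = q l" if b: "edge b" and l: "l \<in> U b" for b l
  proof (rule analytic_continuation_open[where s = "U b \<inter> {l. Re (l * 1) > w}" and s' = "U b"
        and f = "\<lambda>l. laplace (ray b) (l * b)" and g = q])
    show "open (U b)" "open (U b \<inter> {l. Re (l * 1) > w})"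
      unfolding U_def by (intro open_Int open_halfplane)+
    show "U b \<inter> {l. Re (l * 1) > w} \<subseteq> U b" by (rule Int_lower1)
    have "convex (U b)" unfolding U_def by (intro convex_Int convex_halfplane)
    then show "connected (U b)" by (rule convex_connected)
    have "of_real (w + 1) \<in> U b \<inter> {l. Re (l * 1) > w}"
      using w b by (simp add: U_def edge_def)
    then show "U b \<inter> {l. Re (l * 1) > w} \<noteq> {}" by blast
    show "q holomorphic_on U b" by (rule holomorphic_on_subset[OF qh]) (auto simp: U_def)
    have "(laplace (ray b) \<circ> (\<lambda>l. l * b)) holomorphic_on U b"
      by (rule holomorphic_on_compose_gen[OF _ laplace_holomorphic[OF cont_ray growth_ray]])
        (use edge_direction[OF b] in \<open>auto intro!: holomorphic_intros simp: U_def\<close>)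
    then show "(\<lambda>l. laplace (ray b) (l * b)) holomorphic_on U b" by (simp add: o_def)
    fix z assume z: "z \<in> U b \<inter> {l. Re (l * 1) > w}"
    then have zw: "Re z > w" "Re (z * b) > w" by (auto simp: U_def)
    have "laplace (ray b) (z * b) = laplace (ray 1) z"
      by (rule laplace_rotate[OF edge_direction[OF b] zw])
    also have "ray 1 = (\<lambda>s. h s - p s)" by (simp add: p_def)
    also have "laplace (\<lambda>s. h s - p s) z = laplace h z - laplace p z"
      by (rule laplace_diff[OF h hb p pb]) (use zw w \<delta> in auto)
    finally show "laplace (ray b) (z * b) = q z" using rh[OF zw(1)] by (simp add: q_def)
  qed (rule l)
  have "(\<lambda>l. exp (l * of_real t) * q l) holomorphic_on {l. Re l > 0}"
    by (intro holomorphic_intros qh)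
  then obtain P where P': "\<And>l. l \<in> {l. Re l > 0} \<Longrightarrow>
      (P has_field_derivative exp (l * of_real t) * q l) (at l within {l. Re l > 0})"
    using holomorphic_convex_primitive'[OF convex_halfspace_Re_gt open_halfspace_Re_gt] by blast
  have P: "(P has_field_derivative exp (l * of_real t) * q l) (at l)" if "Re l > 0" for l
    using P'[of l] that at_within_open[OF _ open_halfspace_Re_gt[of 0], of l] by auto
  have const: "edge_integral t b l + P l = edge_integral t b l' + P l'" if b: "edge b" and l: "l \<in> U b" "l' \<in> U b" for b l l'
  proof -
    have "((\<lambda>l. edge_integral t b l + P l) has_field_derivative 0) (at z within U b)" if z: "z \<in> U b" for z
    proof -
      have "((\<lambda>l. edge_integral t b l + P l) has_field_derivative
          - (exp (z * of_real t) * laplace (ray b) (z * b)) + exp (z * of_real t) * q z) (at z)"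
        by (rule DERIV_add[OF edge_integral_derivative[OF b t] P]) (use z in \<open>auto simp: U_def\<close>)
      then show ?thesis using q_ray[OF b z] has_field_derivative_at_within by fastforce
    qed
    moreover have "convex (U b)" unfolding U_def by (intro convex_Int convex_halfplane)
    ultimately obtain c where "\<forall>z\<in>U b. edge_integral t b z + P z = c"
      using has_field_derivative_zero_constant by blast
    then show ?thesis using l by simp
  qed
  define b where "b = Complex 1 (- m)"
  define b' where "b' = Complex 1 m"
  have b: "edge b" "edge b'" using m by (auto simp: b_def b'_def edge_def)
  \<comment> \<open>A real point of the common domain, where the Cauchy formula on the two edges applies.\<close>
  define l0 :: complex where "l0 = of_real (w + 1)"
  define l where "l = Complex a K"
  define l' where "l' = Complex a (- K)"
  have mK: "m * K = w + 1" using m by (simp add: K_def)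
  have Re_l: "Re (l * b) = a + (w + 1)" "Re (l' * b') = a + (w + 1)"
    using mK by (simp_all add: l_def l'_def b_def b'_def mult.commute)
  have l0: "l0 \<in> U b" "l0 \<in> U b'" using w by (auto simp: U_def l0_def b_def b'_def)
  have l: "l \<in> U b" "l' \<in> U b'"
    using Re_l a w by (auto simp: U_def simp del: times_complex.sel) (auto simp: l_def l'_def)
  have "2 * of_real pi * \<i> * f (of_real t) = edge_integral t b l0 - edge_integral t b' l0"
    using cauchy_formula_edges[OF t, of "w + 1"]
    by (simp add: edge_integral_def l0_def b_def b'_def right_diff_distrib)
  also have "\<dots> = edge_integral t b l - edge_integral t b' l' + (P l - P l')"
  proof -
    have "edge_integral t b l0 = edge_integral t b l + P l - P l0" "edge_integral t b' l0 = edge_integral t b' l' + P l' - P l0"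
      using const[OF b(1) l0(1) l(1)] const[OF b(2) l0(2) l(2)] by (simp_all add: eq_diff_eq)
    then show ?thesis by simp
  qed
  finally have eq: "2 * of_real pi * \<i> * f (of_real t) = edge_integral t b l - edge_integral t b' l' + (P l - P l')" .
  have "2 * pi * cmod (f (of_real t)) = cmod (2 * of_real pi * \<i> * f (of_real t))"
    by (simp add: norm_mult)
  also have "\<dots> \<le> (cmod (edge_integral t b l) + cmod (edge_integral t b' l')) + cmod (P l - P l')"
    unfolding eq by (intro norm_triangle_le add_mono norm_triangle_ineq4 order_refl)
  also have "\<dots> \<le> (exp (a * t) * (4 * M / (m * t)) + exp (a * t) * (4 * M / (m * t)))
      + (exp (a * t) * (B + N / \<delta>)) * (2 * K)"
  proof (intro add_mono)
    show "cmod (edge_integral t b l) \<le> exp (a * t) * (4 * M / (m * t))"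
      using edge_integral_bound[OF b(1) t, of l] Re_l a by (simp add: l_def)
    show "cmod (edge_integral t b' l') \<le> exp (a * t) * (4 * M / (m * t))"
      using edge_integral_bound[OF b(2) t, of l'] Re_l a by (simp add: l'_def)
    have "cmod (P l - P l') \<le> (exp (a * t) * (B + N / \<delta>)) * cmod (l - l')"
    proof (rule field_differentiable_bound[where S = "{z. Re z = a}"])
      show "convex {z. Re z = a}"
        unfolding convex_def by (auto simp flip: distrib_right)
      fix z assume z: "z \<in> {z. Re z = a}"
      then show "(P has_field_derivative exp (z * of_real t) * q z) (at z within {z. Re z = a})"
        using a by (intro has_field_derivative_at_within[OF P]) auto
      show "cmod (exp (z * of_real t) * q z) \<le> exp (a * t) * (B + N / \<delta>)"
        using z qB[of z] by (auto simp: norm_mult)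
    qed (auto simp: l_def l'_def)
    moreover have "cmod (l - l') = 2 * K"
    proof -
      have "l - l' = of_real (2 * K) * \<i>" by (simp add: l_def l'_def complex_eq_iff)
      then show ?thesis using K by (simp add: norm_mult)
    qed
    ultimately show "cmod (P l - P l') \<le> (exp (a * t) * (B + N / \<delta>)) * (2 * K)" by simp
  qed
  also have "\<dots> = exp (a * t) * (8 * M / (m * t) + 2 * K * (B + N / \<delta>))"
    by (simp add: algebra_simps)
  finally show ?thesis unfolding K_def .
qed

end

section \<open>Resolvents and orbits of a semigroup\<close>

lemma scaleC_zero_left: "0 *\<^sub>C (x::'a::complex_normed_vector) = 0"
  using scaleC_of_real[of 0 x] by simp

lemma scaleC_minus_left: "(- a) *\<^sub>C (x::'a::complex_normed_vector) = - (a *\<^sub>C x)"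
  using scaleC_add_left[of a "- a" x] by (simp add: scaleC_zero_left eq_neg_iff_add_eq_0 add.commute)

lemma scaleC_minus_right: "a *\<^sub>C (- x::'a::complex_normed_vector) = - (a *\<^sub>C x)"
  using bounded_linear.linear[OF bounded_linear_scaleC_right[of a]] by (rule linear_neg)

text \<open>The resolvent set refers to $z - A$, the estimates to $z + A$; this lemma transports the
  properties across the sign.\<close>

lemma resolvent_properties:
  fixes A :: "'a::complex_banach \<Rightarrow> 'a"
  assumes z: "- z \<in> resolvent_set D A"
  defines "R \<equiv> the_inv_into D (\<lambda>x. z *\<^sub>C x + A x)"
  shows resolvent_bounded_linear: "bounded_linear R"
    and resolvent_scaleC: "R (c *\<^sub>C y) = c *\<^sub>C R y"
    and resolvent_in_domain: "R y \<in> D"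
    and resolvent_right_inverse: "z *\<^sub>C R y + A (R y) = y"
    and resolvent_left_inverse: "x \<in> D \<Longrightarrow> R (z *\<^sub>C x + A x) = x"
proof -
  have eq: "(- z) *\<^sub>C x - A x = - (z *\<^sub>C x + A x)" for x
    by (simp add: scaleC_minus_left)
  obtain R' where bij': "bij_betw (\<lambda>x. - (z *\<^sub>C x + A x)) D UNIV" and R': "R' \<in> bounded_operators"
    "blinfun_apply R' = the_inv_into D (\<lambda>x. - (z *\<^sub>C x + A x))"
    using z unfolding resolvent_set_def mem_Collect_eq eq by blast
  have inj: "inj_on (\<lambda>x. z *\<^sub>C x + A x) D"
    by (rule inj_onI, rule inj_onD[OF bij_betw_imp_inj_on[OF bij']]) (simp_all only:)
  have surj: "(\<lambda>x. - (z *\<^sub>C x + A x)) ` D = UNIV" by (rule bij_betw_imp_surj_on[OF bij'])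
  have R'_D: "R' y \<in> D" for y
    unfolding R'(2) by (rule the_inv_into_into[OF bij_betw_imp_inj_on[OF bij']]) (simp_all only: surj UNIV_I order_refl)
  have R'_inv: "z *\<^sub>C R' y + A (R' y) = - y" for y
  proof (rule equation_minus_iff[THEN iffD2])
    show "y = - (z *\<^sub>C R' y + A (R' y))"
      unfolding R'(2) by (rule f_the_inv_into_f_bij_betw[OF bij', symmetric]) simp
  qed
  have RR': "R y = - R' y" for y
  proof -
    have "z *\<^sub>C R' (- y) + A (R' (- y)) = y" using R'_inv[of "- y"] by simp
    then have "R y = R' (- y)" unfolding R_def by (rule the_inv_into_f_eq[OF inj _ R'_D])
    then show ?thesis by (simp add: blinfun.minus_right)
  qed
  show "bounded_linear R"
    unfolding RR'[abs_def] by (rule bounded_linear_minus[OF blinfun.bounded_linear_right])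
  show "R (c *\<^sub>C y) = c *\<^sub>C R y"
    using R'(1) by (simp add: RR' bounded_operators_def scaleC_minus_right)
  have *: "R y = R' (- y)" for y by (simp add: RR' blinfun.minus_right)
  show "R y \<in> D" unfolding * by (rule R'_D)
  show "z *\<^sub>C R y + A (R y) = y" unfolding * using R'_inv[of "- y"] by simp
  show "R (z *\<^sub>C x + A x) = x" if "x \<in> D"
    unfolding R_def using the_inv_into_f_f[OF inj that] .
qed

lemma resolvent_identity:
  fixes A :: "'a::complex_banach \<Rightarrow> 'a"
  assumes z: "- z \<in> resolvent_set D A" and v: "- v \<in> resolvent_set D A"
  defines "R \<equiv> \<lambda>z. the_inv_into D (\<lambda>x. z *\<^sub>C x + A x)"
  shows "R z y - R v y = (v - z) *\<^sub>C R v (R z y)"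
proof -
  interpret Rv: bounded_linear "R v" unfolding R_def by (rule resolvent_bounded_linear[OF v])
  have "v *\<^sub>C R z y + A (R z y) = (z *\<^sub>C R z y + A (R z y)) + (v - z) *\<^sub>C R z y"
    using scaleC_add_left[of z "v - z" "R z y"] by (simp add: algebra_simps)
  also have "\<dots> = y + (v - z) *\<^sub>C R z y"
    unfolding R_def resolvent_right_inverse[OF z] ..
  finally have "R v (y + (v - z) *\<^sub>C R z y) = R z y"
    using resolvent_left_inverse[OF v resolvent_in_domain[OF z], of y] by (simp add: R_def)
  moreover have "R v ((v - z) *\<^sub>C R z y) = (v - z) *\<^sub>C R v (R z y)"
    unfolding R_def by (rule resolvent_scaleC[OF v])
  ultimately show ?thesis by (simp add: Rv.add algebra_simps)
qed

text \<open>The resolvent identity gives the difference quotients, and the monotone bound keeps the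
  resolvent bounded near each point, which makes it continuous there.\<close>

lemma resolvent_holomorphic:
  fixes A :: "'a::complex_banach \<Rightarrow> 'a" and D :: "'a set"
  defines "R \<equiv> \<lambda>z. the_inv_into D (\<lambda>x. z *\<^sub>C x + A x)"
  assumes res: "\<And>z. Re z > 0 \<Longrightarrow> - z \<in> resolvent_set D A"
    and g: "mono_on {0<..} g" and bd: "\<And>z. Re z > 0 \<Longrightarrow> onorm (R z) \<le> g (inverse (Re z))"
    and l: "bounded_linear l" "\<And>c y. l (c *\<^sub>C y) = c * l y" "\<And>y. cmod (l y) \<le> norm y"
  shows "(\<lambda>z. l (R z y)) holomorphic_on {z. Re z > 0}"
proof -
  interpret l: bounded_linear l by (rule l(1))
  have norm_R: "norm (R z y) \<le> g (inverse (Re z)) * norm y" if "Re z > 0" for z y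
  proof -
    have "norm (R z y) \<le> onorm (R z) * norm y"
      unfolding R_def by (rule onorm[OF resolvent_bounded_linear[OF res[OF that]]])
    also have "\<dots> \<le> g (inverse (Re z)) * norm y" by (rule mult_right_mono[OF bd[OF that]]) simp
    finally show ?thesis .
  qed
  have "((\<lambda>z. l (R z y)) has_field_derivative - l (R z (R z y))) (at z)" if z: "Re z > 0" for z
  proof -
    define x where "x = R z y"
    have near: "\<forall>\<^sub>F v in at z. Re v > Re z / 2"
      by (rule order_tendstoD(1)[OF tendsto_Re[OF tendsto_ident_at]]) (use z in simp)
    have quot: "\<forall>\<^sub>F v in at z. - l (R v x) = (l (R v y) - l (R z y)) / (v - z)"
      using near eventually_neq_at_within[of z z UNIV]
    proof (eventually_elim)
      case (elim v)
      have v: "Re v > 0" using elim(1) z by simp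
      have "l (R z y) - l (R v y) = l (R z y - R v y)" by (rule l.diff[symmetric])
      also have "\<dots> = l ((v - z) *\<^sub>C R v x)"
        using resolvent_identity[OF res[OF z] res[OF v], of y] unfolding R_def x_def by (rule arg_cong)
      also have "\<dots> = (v - z) * l (R v x)" by (rule l(2))
      finally have "l (R v y) - l (R z y) = (v - z) * (- l (R v x))" by (simp add: algebra_simps)
      then show ?case using elim(2) by simp
    qed
    have "((\<lambda>v. l (R v x) - l (R z x)) \<longlongrightarrow> 0) (at z)"
    proof (rule Lim_null_comparison)
      show "\<forall>\<^sub>F v in at z. cmod (l (R v x) - l (R z x)) \<le> cmod (z - v) * (g (2 / Re z) * norm (R z x))"
        using near
      proof eventually_elim
        case (elim v)
        have v: "Re v > 0" using elim z by simp
        have "cmod (l (R v x) - l (R z x)) \<le> norm (R v x - R z x)"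
          using l(3)[of "R v x - R z x"] by (simp add: l.diff)
        also have "\<dots> = norm ((v - z) *\<^sub>C R v (R z x))"
          using resolvent_identity[OF res[OF z] res[OF v], of x] norm_minus_commute[of "R v x" "R z x"]
          unfolding R_def by simp
        also have "\<dots> = cmod (z - v) * norm (R v (R z x))"
          unfolding norm_scaleC by (simp add: norm_minus_commute)
        also have "\<dots> \<le> cmod (z - v) * (g (2 / Re z) * norm (R z x))"
        proof (intro mult_left_mono)
          have "norm (R v (R z x)) \<le> g (inverse (Re v)) * norm (R z x)" by (rule norm_R[OF v])
          also have "g (inverse (Re v)) \<le> g (2 / Re z)"
            using elim z v by (intro mono_onD[OF g]) (auto simp: field_simps)
          then have "g (inverse (Re v)) * norm (R z x) \<le> g (2 / Re z) * norm (R z x)"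
            by (rule mult_right_mono) simp
          finally show "norm (R v (R z x)) \<le> g (2 / Re z) * norm (R z x)" .
        qed simp
        finally show ?case .
      qed
      show "((\<lambda>v. cmod (z - v) * (g (2 / Re z) * norm (R z x))) \<longlongrightarrow> 0) (at z)"
        by (auto intro!: tendsto_eq_intros)
    qed
    then have "((\<lambda>v. - l (R v x)) \<longlongrightarrow> - l (R z x)) (at z)"
      by (intro tendsto_minus) (simp add: Lim_null[symmetric])
    then have "((\<lambda>v. (l (R v y) - l (R z y)) / (v - z)) \<longlongrightarrow> - l (R z x)) (at z)"
      by (rule Lim_transform_eventually[OF _ quot])
    then show ?thesis unfolding has_field_derivative_iff x_def .
  qed
  then show ?thesis
    unfolding holomorphic_on_def field_differentiable_def using has_field_derivative_at_within by blast
qed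

lemma has_vector_derivativeI_quotient:
  fixes f :: "real \<Rightarrow> 'a::real_normed_vector"
  assumes "((\<lambda>h. (1 / h) *\<^sub>R (f (s + h) - f s)) \<longlongrightarrow> d) (at 0)"
  shows "(f has_vector_derivative d) (at s)"
  unfolding has_vector_derivative_def has_derivative_at
proof (intro conjI bounded_linear_scaleR_left)
  have "((\<lambda>h. norm ((1 / h) *\<^sub>R (f (s + h) - f s) - d)) \<longlongrightarrow> 0) (at 0)"
    using assms by (intro tendsto_norm_zero) (simp add: Lim_null[symmetric])
  moreover have "\<forall>\<^sub>F h in at 0. norm ((1 / h) *\<^sub>R (f (s + h) - f s) - d)
      = norm (f (s + h) - f s - h *\<^sub>R d) / norm h"
    unfolding eventually_at_filter
  proof (intro always_eventually allI impI)
    fix h :: real assume h: "h \<noteq> 0"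
    have "f (s + h) - f s - h *\<^sub>R d = h *\<^sub>R ((1 / h) *\<^sub>R (f (s + h) - f s) - d)"
      using h by (simp add: scaleR_diff_right)
    then show "norm ((1 / h) *\<^sub>R (f (s + h) - f s) - d) = norm (f (s + h) - f s - h *\<^sub>R d) / norm h"
      using h by simp
  qed
  ultimately show "(\<lambda>h. norm (f (s + h) - f s - h *\<^sub>R d) / norm h) \<midarrow>0\<rightarrow> 0"
    by (rule Lim_transform_eventually)
qed

text \<open>The generator provides only the right derivative at $0$.  For the left derivative at $s$ the quotient is
  $T(s - k)\,k^{-1}(T(k)x - x)$, where strong continuity and local boundedness of $T$ allow the
  limit in both factors.\<close>

lemma orbit_derivative:
  fixes T :: "real \<Rightarrow> 'a::complex_banach \<Rightarrow>\<^sub>L 'a"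
  assumes C0: "C0_semigroup T" and gen: "is_generator T D (\<lambda>x. - A x)"
    and bd: "\<And>t. t > 0 \<Longrightarrow> norm (T t) \<le> W * exp (c * t)" and c: "c \<ge> 0"
    and x: "x \<in> D" and s: "s > 0"
  shows "((\<lambda>s. T s x) has_vector_derivative T s (- A x)) (at s)"
proof (rule has_vector_derivativeI_quotient)
  have lim: "((\<lambda>t. (1 / t) *\<^sub>R (T t x - x)) \<longlongrightarrow> - A x) (at_right 0)"
    using gen x unfolding is_generator_def by blast
  have semi: "T (a + b) y = T a (T b y)" if "a \<ge> 0" "b \<ge> 0" for a b y
    using C0 that unfolding C0_semigroup_def by simp
  have cont: "continuous_on {0..} (\<lambda>t. T t y)" for y
    using C0 unfolding C0_semigroup_def by blast
  have right: "((\<lambda>h. (1 / h) *\<^sub>R (T (s + h) x - T s x)) \<longlongrightarrow> T s (- A x)) (at_right 0)"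
  proof (rule Lim_transform_eventually)
    show "((\<lambda>h. T s ((1 / h) *\<^sub>R (T h x - x))) \<longlongrightarrow> T s (- A x)) (at_right 0)"
      by (rule blinfun.tendsto[OF tendsto_const lim])
    show "\<forall>\<^sub>F h in at_right 0. T s ((1 / h) *\<^sub>R (T h x - x)) = (1 / h) *\<^sub>R (T (s + h) x - T s x)"
      using eventually_at_right_less[of 0]
      by eventually_elim (use s in \<open>simp add: semi blinfun.scaleR_right blinfun.diff_right\<close>)
  qed
  have W: "W \<ge> 0"
    using order_trans[OF norm_ge_zero bd[of 1]] by (simp add: zero_le_mult_iff)
  have ev: "\<forall>\<^sub>F k in at_right 0. 0 < k \<and> k < s"
    using eventually_at_right_real[OF s] by eventually_elim auto
  have lim': "((\<lambda>k. T (s - k) ((1 / k) *\<^sub>R (T k x - x)) - T (s - k) (- A x)) \<longlongrightarrow> 0) (at_right 0)"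
  proof (rule Lim_null_comparison)
    show "\<forall>\<^sub>F k in at_right 0. norm (T (s - k) ((1 / k) *\<^sub>R (T k x - x)) - T (s - k) (- A x))
        \<le> W * exp (c * s) * norm ((1 / k) *\<^sub>R (T k x - x) - (- A x))"
      using ev
    proof eventually_elim
      case (elim k)
      have "norm (T (s - k) ((1 / k) *\<^sub>R (T k x - x)) - T (s - k) (- A x))
          \<le> norm (T (s - k)) * norm ((1 / k) *\<^sub>R (T k x - x) - (- A x))"
        unfolding blinfun.diff_right[symmetric] by (rule norm_blinfun)
      also have "norm (T (s - k)) \<le> W * exp (c * (s - k))" using bd[of "s - k"] elim by simp
      also have "\<dots> \<le> W * exp (c * s)"
        using W c elim by (intro mult_left_mono) (auto simp: algebra_simps)
      finally show ?case by (simp add: mult_right_mono)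
    qed
    have "((\<lambda>k. norm ((1 / k) *\<^sub>R (T k x - x) - (- A x))) \<longlongrightarrow> 0) (at_right 0)"
      using tendsto_diff[OF lim tendsto_const[of "- A x"]] by (intro tendsto_norm_zero) simp
    from tendsto_mult[OF tendsto_const this]
    show "((\<lambda>k. W * exp (c * s) * norm ((1 / k) *\<^sub>R (T k x - x) - (- A x))) \<longlongrightarrow> 0) (at_right 0)"
      by simp
  qed
  have lim'': "((\<lambda>k. T (s - k) (- A x)) \<longlongrightarrow> T s (- A x)) (at_right 0)"
  proof -
    have "isCont (\<lambda>t. T t (- A x)) s"
      using continuous_on_interior[OF cont[of "- A x"], of s] s by (simp add: interior_Ici[of _ "-1"])
    moreover have "((\<lambda>k. s - k) \<longlongrightarrow> s) (at_right 0)" by (auto intro!: tendsto_eq_intros)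
    ultimately show ?thesis by (rule isCont_tendsto_compose)
  qed
  have "((\<lambda>k. T (s - k) ((1 / k) *\<^sub>R (T k x - x))) \<longlongrightarrow> T s (- A x)) (at_right 0)"
    using tendsto_add[OF lim' lim''] by simp
  then have "((\<lambda>k. (1 / (- k)) *\<^sub>R (T (s + - k) x - T s x)) \<longlongrightarrow> T s (- A x)) (at_right 0)"
  proof (rule Lim_transform_eventually)
    show "\<forall>\<^sub>F k in at_right 0. T (s - k) ((1 / k) *\<^sub>R (T k x - x)) = (1 / (- k)) *\<^sub>R (T (s + - k) x - T s x)"
      using ev
    proof eventually_elim
      case (elim k)
      have "T s x = T (s - k) (T k x)" using semi[of "s - k" k x] elim by simp
      then show ?case by (simp add: blinfun.scaleR_right blinfun.diff_right scaleR_diff_right)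
    qed
  qed
  then have left: "((\<lambda>h. (1 / h) *\<^sub>R (T (s + h) x - T s x)) \<longlongrightarrow> T s (- A x)) (at_left 0)"
    by (simp add: filterlim_at_left_to_right[of _ _ 0])
  show "((\<lambda>h. (1 / h) *\<^sub>R (T (s + h) x - T s x)) \<longlongrightarrow> T s (- A x)) (at 0)"
    using left right by (simp add: filterlim_at_split)
qed

text \<open>By the fundamental theorem of calculus for $s \mapsto e^{-zs}T(s)x$, the truncated transform of the orbit of
  $(z + A)x$ differs from $x$ by an exponentially small term.\<close>

lemma laplace_orbit:
  fixes T :: "real \<Rightarrow> 'a::complex_banach \<Rightarrow>\<^sub>L 'a"
  assumes C0: "C0_semigroup T" and gen: "is_generator T D (\<lambda>x. - A x)"
    and bd: "\<And>t. t > 0 \<Longrightarrow> norm (T t) \<le> W * exp (c * t)" and c: "c \<ge> 0"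
    and x: "x \<in> D" and z: "Re z > c"
    and l: "bounded_linear l" "\<And>c y. l (c *\<^sub>C y) = c * l y" "\<And>y. cmod (l y) \<le> norm y"
  shows "laplace (\<lambda>s. l (T s (z *\<^sub>C x + A x))) z = l x"
proof (rule laplace_eqI)
  interpret l: bounded_linear l by (rule l(1))
  define F where "F s = exp (- z * of_real s) * l (T s x)" for s
  have T0: "T 0 = id_blinfun" and cont: "continuous_on {0..} (\<lambda>t. T t x)"
    using C0 unfolding C0_semigroup_def by blast+
  have F0: "F 0 = l x" by (simp add: F_def T0)
  have contF: "continuous_on {0..} F"
    unfolding F_def by (intro continuous_intros l.continuous_on cont)
  have Fder: "(F has_vector_derivative - (exp (- z * of_real s) * l (T s (z *\<^sub>C x + A x)))) (at s)"
    if s: "s > 0" for s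
  proof -
    have 1: "((\<lambda>s. l (T s x)) has_vector_derivative l (T s (- A x))) (at s)"
      by (rule l.has_vector_derivative[OF orbit_derivative[OF C0 gen bd c x s]])
    have 2: "((\<lambda>s. exp (- z * of_real s)) has_vector_derivative - z * exp (- z * of_real s)) (at s)"
    proof -
      have "((\<lambda>v. exp (- z * v)) has_field_derivative - z * exp (- z * of_real s)) (at (of_real s))"
        by (auto intro!: derivative_eq_intros)
      from has_vector_derivative_real_field[OF this] show ?thesis by simp
    qed
    have "(F has_vector_derivative exp (- z * of_real s) * l (T s (- A x)) + (- z * exp (- z * of_real s)) * l (T s x)) (at s)"
      unfolding F_def by (rule has_vector_derivative_mult[OF 2 1])
    moreover have "T s (z *\<^sub>C x) = z *\<^sub>C T s x"
      using C0 s unfolding C0_semigroup_def bounded_operators_def by force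
    ultimately show ?thesis
      by (simp add: blinfun.add_right blinfun.minus_right l.add l.neg l(2) algebra_simps)
  qed
  have upto: "laplace_upto (real n) (\<lambda>s. l (T s (z *\<^sub>C x + A x))) z = l x - F (real n)" for n
  proof -
    have "((\<lambda>s. - (exp (- z * of_real s) * l (T s (z *\<^sub>C x + A x)))) has_integral F (real n) - F 0) {0..real n}"
    proof (rule fundamental_theorem_of_calculus_interior)
      show "continuous_on {0..real n} F" by (rule continuous_on_subset[OF contF]) auto
      show "(F has_vector_derivative - (exp (- z * of_real s) * l (T s (z *\<^sub>C x + A x)))) (at s)"
        if "s \<in> {0<..<real n}" for s by (rule Fder) (use that in simp)
    qed simp
    from has_integral_neg[OF this] show ?thesis
      unfolding laplace_upto_def F0 by (simp add: integral_unique)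
  qed
  have "(\<lambda>n. F (real n)) \<longlonglongrightarrow> 0"
  proof (rule Lim_null_comparison)
    show "\<forall>\<^sub>F n in sequentially. cmod (F (real n)) \<le> (W * norm x) * exp (- (Re z - c) * real n)"
      using eventually_gt_at_top[of 0]
    proof eventually_elim
      case (elim n)
      have "cmod (l (T (real n) x)) \<le> norm (T (real n)) * norm x"
        using l(3) norm_blinfun order_trans by blast
      also have "\<dots> \<le> W * exp (c * real n) * norm x"
        using bd[of "real n"] elim by (intro mult_right_mono) auto
      finally have "cmod (F (real n)) \<le> exp (- Re z * real n) * (W * exp (c * real n) * norm x)"
        unfolding F_def norm_mult by (intro mult_mono) auto
      also have "\<dots> = (W * norm x) * exp (- (Re z - c) * real n)"
        by (simp add: algebra_simps flip: exp_add)
      finally show ?case .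
    qed
  qed (rule exp_decay_nat, use z in simp)
  from tendsto_diff[OF tendsto_const this]
  show "(\<lambda>n. laplace_upto (real n) (\<lambda>s. l (T s (z *\<^sub>C x + A x))) z) \<longlonglongrightarrow> l x"
    by (simp add: upto)
qed

section \<open>From scalar functions to the semigroup\<close>

text \<open>In the right half-plane $\mathrm{Arg}\,z = \arctan(\mathrm{Im}\,z/\mathrm{Re}\,z)$, so the slope $\tan\psi$
  corresponds to the angle $\psi$.\<close>

lemma cone_in_sector:
  assumes "\<bar>Im z\<bar> < tan \<psi> * Re z" "0 < \<psi>" "\<psi> < pi / 2"
  shows "z \<in> sector \<psi>"
proof -
  have tan: "tan \<psi> > 0" using assms(2,3) by (rule tan_gt_zero)
  have "0 < tan \<psi> * Re z" using assms(1) by linarith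
  then have Re: "Re z > 0" using tan by (simp add: zero_less_mult_iff)
  have "\<bar>Arg z\<bar> = arctan \<bar>Im z / Re z\<bar>"
    unfolding arg_conv_arctan[OF Re] by (auto simp: abs_if arctan_minus)
  also have "\<dots> < arctan (tan \<psi>)"
    unfolding arctan_less_iff using assms(1) Re by (simp add: abs_divide pos_divide_less_eq)
  also have "\<dots> = \<psi>" using assms by (intro arctan_tan) auto
  finally show ?thesis using Re by (auto simp: sector_def)
qed

text \<open>A negative growth bound is witnessed by a negative exponent.  On a cone of slope at most one
  $|z| \le 2\,\mathrm{Re}\,z$, so that bounds in $|z|$ become bounds in $\mathrm{Re}\,z$.\<close>

lemma asymptotically_analytic_cone:
  assumes "asymptotically_analytic T"
  obtains m w \<delta> F M N where "0 < m" "m \<le> 1" "w \<ge> 0" "\<delta> > 0"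
    "vector_holomorphic_on F {z. \<bar>Im z\<bar> < m * Re z}"
    "\<And>z. \<bar>Im z\<bar> < m * Re z \<Longrightarrow> norm (F z) \<le> M * exp (w * Re z)"
    "\<And>t. t > 0 \<Longrightarrow> norm (T t - F (of_real t)) \<le> N * exp (- \<delta> * t)"
proof -
  obtain \<omega> S where \<omega>: "\<omega> < 0" and S: "S \<in> analytic_families"
    and bdd: "bdd_above ((\<lambda>t. exp (- \<omega> * t) * norm (T t - S t)) ` {0<..})"
    using assms unfolding asymptotically_analytic_def nonanalytic_growth_bound_def Inf_less_iff by auto
  obtain \<phi> F M0 w0 where \<phi>: "0 < \<phi>" and hol: "vector_holomorphic_on F (sector \<phi>)"
    and gr: "\<And>z. z \<in> sector \<phi> \<Longrightarrow> norm (F z) \<le> M0 * exp (w0 * cmod z)"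
    and FS: "\<And>t. t > 0 \<Longrightarrow> F (complex_of_real t) = S t"
    using S unfolding analytic_families_def by blast
  obtain N where N: "\<And>t. t > 0 \<Longrightarrow> exp (- \<omega> * t) * norm (T t - S t) \<le> N"
    using bdd unfolding bdd_above_def by auto
  \<comment> \<open>The restriction to $\pi/4$ yields the slope bound $m \le 1$.\<close>
  define \<psi> where "\<psi> = min \<phi> (pi / 4)"
  have \<psi>: "0 < \<psi>" "\<psi> \<le> pi / 4" "\<psi> \<le> \<phi>" using \<phi> by (auto simp: \<psi>_def)
  have \<psi>2: "\<psi> < pi / 2" using \<psi> pi_gt_zero by linarith
  define m where "m = tan \<psi>"
  have m: "0 < m" unfolding m_def by (rule tan_gt_zero[OF \<psi>(1) \<psi>2])
  have "arctan m \<le> arctan 1"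
    using arctan_tan[of \<psi>] \<psi> \<psi>2 by (simp add: m_def arctan_one)
  then have m1: "m \<le> 1" by (simp only: arctan_le_iff)
  define K where "K = {z. \<bar>Im z\<bar> < m * Re z}"
  have sub: "K \<subseteq> sector \<phi>"
    using cone_in_sector[OF _ \<psi>(1) \<psi>2] \<psi>(3) unfolding K_def m_def sector_def by fastforce
  define w where "w = 2 * \<bar>w0\<bar>"
  show thesis
  proof (rule that[of m w "- \<omega>" F M0 N])
    show "vector_holomorphic_on F {z. \<bar>Im z\<bar> < m * Re z}"
      using hol sub unfolding vector_holomorphic_on_def K_def[symmetric]
      by (meson has_derivative_subset subset_iff)
    show "norm (F z) \<le> M0 * exp (w * Re z)" if z: "\<bar>Im z\<bar> < m * Re z" for z
    proof -
      have le: "norm (F z) \<le> M0 * exp (w0 * cmod z)" using gr z sub by (auto simp: K_def)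
      then have M0: "M0 \<ge> 0" using order_trans[OF norm_ge_zero le] by (simp add: zero_le_mult_iff)
      have "0 < m * Re z" using z by linarith
      then have Re: "Re z > 0" using m by (simp add: zero_less_mult_iff)
      have "m * Re z \<le> 1 * Re z" using m1 Re by (intro mult_right_mono) auto
      then have "cmod z \<le> 2 * Re z" using cmod_le[of z] z by linarith
      then have "w0 * cmod z \<le> \<bar>w0\<bar> * (2 * Re z)" by (intro mult_mono) auto
      then have "M0 * exp (w0 * cmod z) \<le> M0 * exp (w * Re z)"
        using M0 by (intro mult_left_mono) (auto simp: w_def)
      with le show ?thesis by linarith
    qed
    show "norm (T t - F (of_real t)) \<le> N * exp (- (- \<omega>) * t)" if t: "t > 0" for t
    proof -
      have "norm (T t - S t) = (exp (- \<omega> * t) * norm (T t - S t)) * exp (\<omega> * t)"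
        by (simp add: exp_minus)
      also have "\<dots> \<le> N * exp (\<omega> * t)" by (intro mult_right_mono N t) simp
      finally show ?thesis using FS[OF t] by simp
    qed
  qed (use m m1 \<omega> in \<open>auto simp: w_def\<close>)
qed

lemma vector_holomorphic_functional:
  fixes F :: "complex \<Rightarrow> 'a::complex_normed_vector \<Rightarrow>\<^sub>L 'a"
  assumes F: "vector_holomorphic_on F U"
    and l: "bounded_linear l" "\<And>c y. l (c *\<^sub>C y) = c * l y"
  shows "(\<lambda>z. l (F z x)) holomorphic_on U"
  unfolding holomorphic_on_def field_differentiable_def
proof
  fix z assume "z \<in> U"
  then obtain F' where F': "(F has_derivative (\<lambda>h. h *\<^sub>C F')) (at z within U)"
    using F unfolding vector_holomorphic_on_def by blast
  have "((\<lambda>z. l (F z x)) has_derivative (\<lambda>h. l ((h *\<^sub>C F') x))) (at z within U)"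
    by (rule bounded_linear.has_derivative[OF l(1)
          bounded_linear.has_derivative[OF blinfun.bounded_linear_left F']])
  moreover have "(\<lambda>h. l ((h *\<^sub>C F') x)) = (*) (l (F' x))"
    by (rule ext) (simp add: l(2))
  ultimately show "\<exists>f'. ((\<lambda>z. l (F z x)) has_field_derivative f') (at z within U)"
    unfolding has_field_derivative_def by (intro exI[of _ "l (F' x)"]) simp
qed

theorem theorem3p6:
  fixes T :: "real \<Rightarrow> 'a::complex_banach \<Rightarrow>\<^sub>L 'a"
    and D :: "'a set" and A :: "'a \<Rightarrow> 'a" and g :: "real \<Rightarrow> real"
  assumes "(UNIV :: 'a set) \<noteq> {0}"
    and "C0_semigroup T"
    and "is_generator T D (\<lambda>x. - A x)"
    and "asymptotically_analytic T"
    and "{z. Re z < 0} \<subseteq> resolvent_set D A"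
    and "\<And>s. s > 0 \<Longrightarrow> g s > 0"
    and "mono_on {0<..} g"
    and "\<And>z. Re z > 0 \<Longrightarrow> onorm (the_inv_into D (\<lambda>x. z *\<^sub>C x + A x)) \<le> g (inverse (Re z))"
  shows "\<exists>C\<ge>0. \<forall>t>0. norm (T t) \<le> C * (g t + 1)"
proof -
  note C0 = assms(2) and gen = assms(3) and gpos = assms(6) and gmono = assms(7)
  define R where "R = (\<lambda>z. the_inv_into D (\<lambda>x. z *\<^sub>C x + A x))"
  have res: "- z \<in> resolvent_set D A" if "Re z > 0" for z
    using assms(5) that by auto
  have Rbd: "onorm (R z) \<le> g (inverse (Re z))" if "Re z > 0" for z
    using assms(8)[OF that] by (simp add: R_def)
  obtain m w \<delta> F M N where m: "0 < m" "m \<le> 1" and w: "w \<ge> 0" and \<delta>: "\<delta> > 0"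
    and Fhol: "vector_holomorphic_on F {z. \<bar>Im z\<bar> < m * Re z}"
    and Fgr: "\<And>z. \<bar>Im z\<bar> < m * Re z \<Longrightarrow> norm (F z) \<le> M * exp (w * Re z)"
    and TF: "\<And>t. t > 0 \<Longrightarrow> norm (T t - F (of_real t)) \<le> N * exp (- \<delta> * t)"
    by (rule asymptotically_analytic_cone[OF assms(4)], rule that; assumption)
  have N: "N \<ge> 0" using order_trans[OF norm_ge_zero TF[of 1]] by (simp add: zero_le_mult_iff)
  have M_nonneg: "M \<ge> 0" using order_trans[OF norm_ge_zero Fgr[of 1]] m by (simp add: zero_le_mult_iff)
  have Tgr: "norm (T t) \<le> (M + N) * exp (w * t)" if t: "t > 0" for t
  proof -
    have "norm (T t) \<le> norm (F (of_real t)) + norm (T t - F (of_real t))"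
      using norm_triangle_ineq[of "F (of_real t)" "T t - F (of_real t)"] by simp
    also have "\<dots> \<le> M * exp (w * t) + N * exp (- \<delta> * t)"
      using Fgr[of "of_real t"] TF[OF t] m t by (intro add_mono) auto
    also have "N * exp (- \<delta> * t) \<le> N * exp (w * t)"
      using mult_right_mono[of "- \<delta>" w t] t w \<delta> N by (intro mult_left_mono) auto
    finally show ?thesis by (simp add: algebra_simps)
  qed
  \<comment> \<open>The summand $N$ accounts for the difference between the orbit and its analytic part.\<close>
  define C1 where "C1 = exp 1 * (8 * (M * exp w) / m + 2 * ((w + 1) / m) * (norm (T 1) + N / \<delta>)) + N"
  have C1: "C1 \<ge> 0" using M_nonneg N m w \<delta> by (simp add: C1_def)
  have pointwise: "norm (T (t + 1) x) \<le> C1 * (g t + 1) * norm x" if t: "t \<ge> 1" for t x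
  proof -
    have t0: "t > 0" using t by simp
    obtain l where l: "bounded_linear l" "\<And>c y. l (c *\<^sub>C y) = c * l y" "\<And>y. cmod (l y) \<le> norm y"
      and lx: "l (T (t + 1) x) = of_real (norm (T (t + 1) x))"
      using norming_functional[of "T (t + 1) x"] by metis
    interpret l: bounded_linear l by (rule l(1))
    have l_op: "cmod (l (B x)) \<le> norm B * norm x" for B :: "'a \<Rightarrow>\<^sub>L 'a"
      using l(3)[of "B x"] norm_blinfun[of B x] by linarith
    define f where "f z = l (F (z + 1) x)" for z
    define h where "h s = l (T (s + 1) x)" for s
    define r where "r z = l (R z (T 1 x))" for z
    have shift: "\<bar>Im (z + 1)\<bar> < m * Re (z + 1)" if "\<bar>Im z\<bar> \<le> m * Re z" for z
      using that m by (simp add: algebra_simps)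
    interpret cone_function f m w "M * exp w * norm x"
    proof
      have "((\<lambda>z. l (F z x)) \<circ> (\<lambda>z. z + 1)) holomorphic_on {z. \<bar>Im z\<bar> < m * (Re z + 1)}"
        by (rule holomorphic_on_compose_gen[OF _ vector_holomorphic_functional[OF Fhol l(1,2)]])
          (auto intro!: holomorphic_intros)
      then show "f holomorphic_on {z. \<bar>Im z\<bar> < m * (Re z + 1)}" by (simp add: f_def[abs_def] o_def)
      fix z assume z: "\<bar>Im z\<bar> \<le> m * Re z"
      have "cmod (f z) \<le> norm (F (z + 1)) * norm x" unfolding f_def by (rule l_op)
      also have "\<dots> \<le> M * exp (w * Re (z + 1)) * norm x"
        by (intro mult_right_mono Fgr shift z) simp
      also have "\<dots> = M * exp w * norm x * exp (w * Re z)" by (simp add: algebra_simps exp_add)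
      finally show "cmod (f z) \<le> M * exp w * norm x * exp (w * Re z)" .
    qed (use m w in auto)
    have hf: "cmod (h s - f (of_real s)) \<le> (N * norm x) * exp (- \<delta> * s)" if s: "s \<ge> 0" for s
    proof -
      have "cmod (h s - f (of_real s)) = cmod (l ((T (s + 1) - F (of_real (s + 1))) x))"
        by (simp add: h_def f_def l.diff blinfun.diff_left)
      also have "\<dots> \<le> norm (T (s + 1) - F (of_real (s + 1))) * norm x" by (rule l_op)
      also have "\<dots> \<le> (N * exp (- \<delta> * (s + 1))) * norm x" using s by (intro mult_right_mono TF) auto
      also have "\<dots> \<le> (N * exp (- \<delta> * s)) * norm x"
        using N \<delta> by (intro mult_right_mono mult_left_mono) auto
      finally show ?thesis by (simp add: mult_ac)
    qed
    have semi: "T (s + 1) x = T s (T 1 x)" if "s \<ge> 0" for s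
      using C0 that unfolding C0_semigroup_def by simp
    have hc: "continuous_on {0..} h"
    proof -
      have "continuous_on {0..} (\<lambda>t. T t x)" using C0 unfolding C0_semigroup_def by blast
      then have "continuous_on {0..} (\<lambda>s. T (s + 1) x)"
        by (rule continuous_on_compose2) (auto intro!: continuous_intros)
      then show ?thesis unfolding h_def by (rule l.continuous_on)
    qed
    have rh: "r z = laplace h z" if z: "Re z > w" for z
    proof -
      have z0: "Re z > 0" using z w by simp
      have "laplace h z = laplace (\<lambda>s. l (T s (T 1 x))) z"
        unfolding laplace_def laplace_upto_def
        by (intro arg_cong[where f = lim] ext integral_cong) (simp add: h_def semi)
      also have "T 1 x = z *\<^sub>C R z (T 1 x) + A (R z (T 1 x))"
        unfolding R_def by (rule resolvent_right_inverse[OF res[OF z0], symmetric])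
      also have "laplace (\<lambda>s. l (T s (z *\<^sub>C R z (T 1 x) + A (R z (T 1 x))))) z = l (R z (T 1 x))"
        by (rule laplace_orbit[OF C0 gen Tgr w _ z l])
          (simp_all add: R_def resolvent_in_domain[OF res[OF z0]])
      finally show ?thesis by (simp add: r_def)
    qed
    have rB: "cmod (r z) \<le> g t * (norm (T 1) * norm x)" if z: "Re z = 1 / t" for z
    proof -
      have z0: "Re z > 0" using z t by simp
      have "cmod (r z) \<le> norm (R z (T 1 x))" unfolding r_def by (rule l(3))
      also have "\<dots> \<le> onorm (R z) * norm (T 1 x)"
        unfolding R_def by (rule onorm[OF resolvent_bounded_linear[OF res[OF z0]]])
      also have "\<dots> \<le> g t * (norm (T 1) * norm x)"
        using Rbd[OF z0] z gpos[OF t0] by (intro mult_mono norm_blinfun) auto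
      finally show ?thesis .
    qed
    \<comment> \<open>The abscissa $a = 1/t$ keeps $e^{at}$ constant and turns the resolvent bound into $g(t)$.\<close>
    have "2 * pi * cmod (f (of_real t)) \<le> exp (1 / t * t) * (8 * (M * exp w * norm x) / (m * t)
        + 2 * ((w + 1) / m) * (g t * (norm (T 1) * norm x) + N * norm x / \<delta>))"
    proof (rule growth_from_laplace_transform[OF hc hf \<delta> _ rh t0 _ rB])
      show "r holomorphic_on {l. Re l > 0}"
        unfolding r_def R_def
        by (rule resolvent_holomorphic[OF res gmono _ l]) (use Rbd in \<open>simp_all add: R_def\<close>)
    qed (use t in auto)
    also have "\<dots> \<le> exp 1 * (8 * (M * exp w) / m
        + 2 * ((w + 1) / m) * (norm (T 1) + N / \<delta>)) * (g t + 1) * norm x"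
    proof -
      have g0: "g t \<ge> 0" using gpos[OF t0] by simp
      have "8 * (M * exp w * norm x) / (m * t) \<le> 8 * (M * exp w * norm x) / m"
        using M_nonneg m t by (intro divide_left_mono) auto
      also have "\<dots> = (8 * (M * exp w) / m) * 1 * norm x" by simp
      also have "\<dots> \<le> (8 * (M * exp w) / m) * (g t + 1) * norm x"
        using M_nonneg m g0 by (intro mult_right_mono mult_left_mono) auto
      finally have 1: "8 * (M * exp w * norm x) / (m * t) \<le> (8 * (M * exp w) / m) * (g t + 1) * norm x" .
      have "g t * (norm (T 1) * norm x) + N * norm x / \<delta> = (g t * norm (T 1) + 1 * (N / \<delta>)) * norm x"
        by (simp add: algebra_simps)
      also have "\<dots> \<le> ((g t + 1) * norm (T 1) + (g t + 1) * (N / \<delta>)) * norm x"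
        using g0 N \<delta> by (intro mult_right_mono add_mono) auto
      also have "\<dots> = (norm (T 1) + N / \<delta>) * (g t + 1) * norm x" by (simp add: algebra_simps)
      finally have "2 * ((w + 1) / m) * (g t * (norm (T 1) * norm x) + N * norm x / \<delta>)
          \<le> 2 * ((w + 1) / m) * ((norm (T 1) + N / \<delta>) * (g t + 1) * norm x)"
        using w m by (intro mult_left_mono) auto
      with 1 have "8 * (M * exp w * norm x) / (m * t)
          + 2 * ((w + 1) / m) * (g t * (norm (T 1) * norm x) + N * norm x / \<delta>)
          \<le> (8 * (M * exp w) / m) * (g t + 1) * norm x
          + 2 * ((w + 1) / m) * ((norm (T 1) + N / \<delta>) * (g t + 1) * norm x)" by (rule add_mono)
      also have "\<dots> = (8 * (M * exp w) / m
        + 2 * ((w + 1) / m) * (norm (T 1) + N / \<delta>)) * ((g t + 1) * norm x)"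
        by (simp only: distrib_right mult.assoc)
      finally show ?thesis using t by simp
    qed
    finally have "2 * pi * cmod (f (of_real t)) \<le> (C1 - N) * (g t + 1) * norm x"
      by (simp add: C1_def)
    moreover have "1 * cmod (f (of_real t)) \<le> 2 * pi * cmod (f (of_real t))"
      using pi_gt3 by (intro mult_right_mono) auto
    ultimately have f_le: "cmod (f (of_real t)) \<le> (C1 - N) * (g t + 1) * norm x" by simp
    have "N * norm x * exp (- \<delta> * t) \<le> N * norm x * 1"
      using N \<delta> t by (intro mult_left_mono) auto
    also have "\<dots> \<le> N * (g t + 1) * norm x"
      using N gpos[OF t0] by (simp add: algebra_simps)
    finally have e_le: "N * norm x * exp (- \<delta> * t) \<le> N * (g t + 1) * norm x" .
    have "norm (T (t + 1) x) = cmod (h t)" unfolding h_def lx by simp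
    also have "\<dots> \<le> cmod (f (of_real t)) + cmod (h t - f (of_real t))"
      using norm_triangle_ineq[of "f (of_real t)" "h t - f (of_real t)"] by simp
    also have "\<dots> \<le> (C1 - N) * (g t + 1) * norm x + N * (g t + 1) * norm x"
      using f_le hf[of t] e_le t by linarith
    finally show ?thesis by (simp add: algebra_simps)
  qed
  \<comment> \<open>For $t \le 2$ the shift by one is not available, and the exponential bound is used instead.\<close>
  define C2 where "C2 = (M + N) * exp (w * 2)"
  have C2: "C2 \<ge> 0" using M_nonneg N by (simp add: C2_def)
  have "norm (T t) \<le> (C1 + C2) * (g t + 1)" if t: "t > 0" for t
  proof (cases "t \<le> 2")
    case True
    have "norm (T t) \<le> (M + N) * exp (w * t)" by (rule Tgr[OF t])
    also have "\<dots> \<le> C2" unfolding C2_def using True w M_nonneg N by (intro mult_left_mono) (auto intro: mult_left_mono)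
    also have "\<dots> \<le> (C1 + C2) * 1" using C1 by simp
    also have "\<dots> \<le> (C1 + C2) * (g t + 1)" using C1 C2 gpos[OF t] by (intro mult_left_mono) auto
    finally show ?thesis .
  next
    case False
    then have t1: "t - 1 \<ge> 1" by simp
    have "norm (T (t - 1 + 1)) \<le> C1 * (g (t - 1) + 1)"
      using pointwise[OF t1] C1 gpos[of "t - 1"] t1 by (intro norm_blinfun_bound) auto
    also have "\<dots> \<le> C1 * (g t + 1)"
      using C1 t1 mono_onD[OF gmono, of "t - 1" t] by (intro mult_left_mono) auto
    also have "\<dots> \<le> (C1 + C2) * (g t + 1)" using C2 gpos[OF t] by (intro mult_right_mono) auto
    finally show ?thesis by simp
  qed
  then show ?thesis using C1 C2 by (intro exI[of _ "C1 + C2"]) auto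
qed

end
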